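(* Let $N\ge2$ and consider $\mathbb{C}^{d_1}\otimes\cdots\otimes\mathbb{C}^{d_N}$ with bases $\{\mathbf{G}^{(l)}_i\}$ and constants $\kappa_l\ge1$ as in the context. If an $N$-partite state $\rho$ is fully separable, then its correlation tensor $\mathcal{T}^{(1\cdots N)}$ satisfies $$\big\|\mathcal{T}^{(1\cdots N)}\big\|_{\rm tr}\le\prod_{l=1}^N\sqrt{\frac{d_l^2-d_l}{\kappa_l}}.$$
   Context: For each $l$, $\{\mathbf{G}^{(l)}_i\}_{i=0}^{d_l^2-1}$ is a basis of complex $d_l\times d_l$ matrices with $\mathbf{G}^{(l)}_0=\mathbf{I}_{d_l}$, $\mathrm{Tr}(\mathbf{G}^{(l)}_i)=0$, $\mathrm{Tr}((\mathbf{G}^{(l)}_i)^\dagger\mathbf{G}^{(l)}_{i'})=\kappa_l\delta_{ii'}$ for $i,i'\ge1$, $\kappa_l\ge1$. $\mathcal{T}^{(1\cdots N)}\in\mathbb{C}^{(d_1^2-1)\times\cdots\times(d_N^2-1)}$ has entries $\frac{d_1\cdots d_N}{\kappa_1\cdots\kappa_N}\mathrm{Tr}\big(\rho(\mathbf{G}^{(1)}_{i_1}\otimes\cdots\otimes\mathbf{G}^{(N)}_{i_N})\big)$, $i_l\in\{1,\dots,d_l^2-1\}$. $\rho$ is fully separable if $\rho=\sum_ip_i\rho^{(1)}_i\otimes\cdots\otimes\rho^{(N)}_i$ with $p_i\ge0$, $\sum p_i=1$, $\rho^{(l)}_i$ pure states on $\mathbb{C}^{d_l}$. Index map: $\iota_n^{(D_1,\dots,D_k)}(j_1,\dots,j_k)=(\prod_{s=1}^nD_s)\sum_{s'=n+1}^k((j_{s'}-1)\prod_{s''=s'+1}^kD_{s''})+\sum_{s'=1}^n((j_{s'}-1)\prod_{s''=s'+1}^nD_{s''})+1$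 (empty products $1$, empty sums $0$). For a tensor $\mathcal{A}=(a_{i_1\cdots i_N})\in\mathbb{C}^{D_1\times\cdots\times D_N}$, disjoint nonempty $R=\{r_1<\cdots<r_k\}$, $C=\{c_1<\cdots<c_{N-k}\}$ with $R\cup C=\{1,\dots,N\}$, $n\in\{1,\dots,k\}$, $m\in\{1,\dots,N-k\}$, the mixed unfolding $\mathbf{A}_{(R,n;C,m)}$ is the $(D_{r_1}\cdots D_{r_k})\times(D_{c_1}\cdots D_{c_{N-k}})$ matrix with $a_{i_1\cdots i_N}$ in row $\iota_n^{(D_{r_1},\dots,D_{r_k})}(i_{r_1},\dots,i_{r_k})$ and column $\iota_m^{(D_{c_1},\dots,D_{c_{N-k}})}(i_{c_1},\dots,i_{c_{N-k}})$. The trace norm of the tensor is $\|\mathcal{A}\|_{\rm tr}=\max\|\mathbf{A}_{(R,n;C,m)}\|_{\rm tr}$, the maximum over all such $R,C,n,m$, where for a matrix $\|\mathbf{X}\|_{\rm tr}=\mathrm{Tr}((\mathbf{X}^\dagger\mathbf{X})^{1/2})$. *)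

theory Defs
  imports "Jordan_Normal_Form.Jordan_Normal_Form" "Jordan_Normal_Form.Schur_Decomposition"
begin

definition kron :: "complex mat \<Rightarrow> complex mat \<Rightarrow> complex mat" where
  "kron A B = mat (dim_row A * dim_row B) (dim_col A * dim_col B)
     (\<lambda>(i, j). A $$ (i div dim_row B, j div dim_col B) * B $$ (i mod dim_row B, j mod dim_col B))"

fun kron_list :: "complex mat list \<Rightarrow> complex mat" where
  "kron_list [] = 1\<^sub>m 1"
| "kron_list [A] = A"
| "kron_list (A # As) = kron A (kron_list As)"

definition mat_trace :: "complex mat \<Rightarrow> complex" where
  "mat_trace A = (\<Sum>i<dim_row A. A $$ (i, i))"

definition hermitian_mat :: "complex mat \<Rightarrow> bool" where
  "hermitian_mat A \<longleftrightarrow> A = mat_adjoint A"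

definition psd_mat :: "complex mat \<Rightarrow> bool" where
  "psd_mat A \<longleftrightarrow> square_mat A \<and> hermitian_mat A \<and>
     (\<forall>v \<in> carrier_vec (dim_row A).
        0 \<le> Re (\<Sum>i<dim_row A. cnj (v $ i) * (A *\<^sub>v v) $ i))"

definition psd_sqrt :: "complex mat \<Rightarrow> complex mat" where
  "psd_sqrt A = (THE Y. Y \<in> carrier_mat (dim_row A) (dim_row A) \<and> psd_mat Y \<and> Y * Y = A)"

definition trace_norm :: "complex mat \<Rightarrow> real" where
  "trace_norm X = Re (mat_trace (psd_sqrt (mat_adjoint X * X)))"

definition pure_state :: "nat \<Rightarrow> complex mat \<Rightarrow> bool" where
  "pure_state d \<sigma> \<longleftrightarrow> (\<exists>v \<in> carrier_vec d. (\<Sum>a<d. (cmod (v $ a))\<^sup>2) = 1 \<and>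
       \<sigma> = mat d d (\<lambda>(a, b). v $ a * cnj (v $ b)))"

definition fully_separable :: "nat \<Rightarrow> (nat \<Rightarrow> nat) \<Rightarrow> complex mat \<Rightarrow> bool" where
  "fully_separable N d \<rho> \<longleftrightarrow>
     (let D = (\<Prod>l=1..N. d l) in
      \<rho> \<in> carrier_mat D D \<and>
      (\<exists>(K::nat) (p :: nat \<Rightarrow> real) (\<sigma> :: nat \<Rightarrow> nat \<Rightarrow> complex mat).
         (\<forall>j<K. 0 \<le> p j) \<and> (\<Sum>j<K. p j) = 1 \<and>
         (\<forall>j<K. \<forall>l\<in>{1..N}. pure_state (d l) (\<sigma> j l)) \<and>
         (\<forall>a<D. \<forall>b<D. \<rho> $$ (a, b) =
              (\<Sum>j<K. complex_of_real (p j) * kron_list (map (\<sigma> j) [1..<N+1]) $$ (a, b)))))"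

text \<open>A tensor of order N with dimensions D 1, ..., D N is a function on multi-indices
  i (with i l \<in> {1..D l} for l \<in> {1..N}).\<close>
definition valid_index :: "nat \<Rightarrow> (nat \<Rightarrow> nat) \<Rightarrow> (nat \<Rightarrow> nat) \<Rightarrow> bool" where
  "valid_index N D i \<longleftrightarrow> (\<forall>l\<in>{1..N}. 1 \<le> i l \<and> i l \<le> D l) \<and> (\<forall>l. l \<notin> {1..N} \<longrightarrow> i l = 0)"

text \<open>The index map iota_n^(D_1,...,D_k)(j_1,...,j_k) (1-based positions, Ds ! (s-1) = D_s).\<close>
definition iota :: "nat \<Rightarrow> nat list \<Rightarrow> nat list \<Rightarrow> nat" where
  "iota n Ds js = (let k = length Ds in
     (\<Prod>s\<in>{1..n}. Ds ! (s - 1)) *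
       (\<Sum>s'\<in>{n+1..k}. (js ! (s' - 1) - 1) * (\<Prod>s''\<in>{s'+1..k}. Ds ! (s'' - 1)))
     + (\<Sum>s'\<in>{1..n}. (js ! (s' - 1) - 1) * (\<Prod>s''\<in>{s'+1..n}. Ds ! (s'' - 1)))
     + 1)"

text \<open>Mixed unfolding A_(R,n;C,m), C = {1..N} - R; entry a_i sits in (1-based) row
  iota_n(i_R) and column iota_m(i_C).\<close>
definition mixed_unfolding ::
  "nat \<Rightarrow> (nat \<Rightarrow> nat) \<Rightarrow> ((nat \<Rightarrow> nat) \<Rightarrow> complex) \<Rightarrow> nat set \<Rightarrow> nat \<Rightarrow> nat \<Rightarrow> complex mat" where
  "mixed_unfolding N D A R n m =
     (let rs = sorted_list_of_set R; cs = sorted_list_of_set ({1..N} - R);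
          DR = map D rs; DC = map D cs in
      mat (prod_list DR) (prod_list DC)
        (\<lambda>(p, q). A (SOME i. valid_index N D i \<and> iota n DR (map i rs) = p + 1
                                              \<and> iota m DC (map i cs) = q + 1)))"

definition tensor_trace_norm :: "nat \<Rightarrow> (nat \<Rightarrow> nat) \<Rightarrow> ((nat \<Rightarrow> nat) \<Rightarrow> complex) \<Rightarrow> real" where
  "tensor_trace_norm N D A = Max {trace_norm (mixed_unfolding N D A R n m) | R n m.
      R \<subseteq> {1..N} \<and> R \<noteq> {} \<and> R \<noteq> {1..N} \<and> 1 \<le> n \<and> n \<le> card R \<and> 1 \<le> m \<and> m \<le> N - card R}"

text \<open>Correlation tensor T^(1...N) (indices i l \<in> {1..d l^2 - 1}).\<close>
definition corr_tensor ::
  "nat \<Rightarrow> (nat \<Rightarrow> nat) \<Rightarrow> (nat \<Rightarrow> real) \<Rightarrow> (nat \<Rightarrow> nat \<Rightarrow> complex mat) \<Rightarrow> complex mat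
    \<Rightarrow> (nat \<Rightarrow> nat) \<Rightarrow> complex" where
  "corr_tensor N d \<kappa> G \<rho> i =
     complex_of_real ((\<Prod>l=1..N. real (d l)) / (\<Prod>l=1..N. \<kappa> l)) *
     mat_trace (\<rho> * kron_list (map (\<lambda>l. G l (i l)) [1..<N+1]))"

end

theory Submission
  imports Defs "Jordan_Normal_Form.Spectral_Radius" "HOL-Analysis.L2_Norm"
begin

text \<open>For a product of pure states the correlation tensor is a product of vectors, so a mixed
  unfolding of the tensor of a separable state is a convex combination of rank-one matrices
  \<open>u w\<^sup>T\<close>: mixed unfoldings only relabel row and column indices by bijections. The trace norm of
  \<open>\<Sum>\<^sub>j p\<^sub>j u\<^sub>j w\<^sub>j\<^sup>T\<close> is at most \<open>\<Sum>\<^sub>j p\<^sub>j \<parallel>u\<^sub>j\<parallel> \<parallel>w\<^sub>j\<parallel>\<close>: pair each right singular vector with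
  its left singular vector and use Bessel's inequality on both sides. Finally
  \<open>\<parallel>u\<^sub>j\<parallel> \<parallel>w\<^sub>j\<parallel>\<close> is the product of the norms of the local coefficient vectors, and Bessel's
  inequality for the orthogonal family \<open>G\<^sub>i\<close> bounds each by \<open>sqrt ((d\<^sup>2 - d) / \<kappa>)\<close>.\<close>

section \<open>Bessel's inequality and adjoints\<close>

text \<open>\<open>trace_norm\<close> is defined through \<open>THE\<close>, so it has no known
  value until the positive square root of \<open>mat_adjoint X * X\<close> is shown to exist and to
  be unique; this is why a spectral theorem and a uniqueness argument precede every estimate. The
  bound for sums of rank-one matrices is not derived from a triangle inequality: testing against
  fixed singular vectors is linear in the matrix, so the sum over \<open>j\<close> comes out at once
  and Cauchy-Schwarz applies to each term separately. \<open>mixed_unfolding\<close> selects a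
  multi-index by \<open>SOME\<close>, and only the bijectivity of the index maps guarantees that
  every entry is the intended one. The constant has three sources: \<open>1 - 1/d\<close> is the
  squared norm of a pure state minus \<open>I/d\<close>, the length \<open>sqrt \<kappa>\<close> of
  the \<open>G i\<close> gives a factor \<open>\<kappa>\<close>, and the normalization of the tensor
  gives \<open>(d / \<kappa>)\<^sup>2\<close>; their product is
  \<open>(d\<^sup>2 - d) / \<kappa>\<close>.\<close>

lemma bessel_inequality:
  fixes f :: "'k \<Rightarrow> 'a \<Rightarrow> complex" and x :: "'a \<Rightarrow> complex"
  assumes K: "finite K"
    and orth: "\<And>k k'. k \<in> K \<Longrightarrow> k' \<in> K \<Longrightarrow>
      (\<Sum>a\<in>S. cnj (f k a) * f k' a) = (if k = k' then 1 else 0)"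
  shows "(\<Sum>k\<in>K. (cmod (\<Sum>a\<in>S. cnj (f k a) * x a))\<^sup>2) \<le> (\<Sum>a\<in>S. (cmod (x a))\<^sup>2)"
proof -
  define c where "c k = (\<Sum>a\<in>S. cnj (f k a) * x a)" for k
  \<comment> \<open>\<open>y\<close> is the orthogonal projection of \<open>x\<close> onto the span
    of the family. All mixed inner products of \<open>x\<close> and \<open>y\<close> equal
    \<open>n\<close>, so the squared distance from \<open>x\<close> to \<open>y\<close> is the
    difference of the two sides of the claim. Vectors are functions on an index set
    \<open>S\<close>, which lets the same inequality serve matrices indexed by pairs.\<close>
  define y where "y a = (\<Sum>k\<in>K. c k * f k a)" for a
  define n where "n = (\<Sum>k\<in>K. cnj (c k) * c k)"
  have yx: "(\<Sum>a\<in>S. cnj (y a) * x a) = n"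
  proof -
    have "(\<Sum>a\<in>S. cnj (y a) * x a) = (\<Sum>a\<in>S. \<Sum>k\<in>K. cnj (c k) * (cnj (f k a) * x a))"
      by (simp add: y_def sum_distrib_right mult.assoc)
    also have "\<dots> = (\<Sum>k\<in>K. \<Sum>a\<in>S. cnj (c k) * (cnj (f k a) * x a))"
      by (rule sum.swap)
    finally show ?thesis
      by (simp add: n_def c_def sum_distrib_left)
  qed
  have fy: "(\<Sum>a\<in>S. cnj (f k a) * y a) = c k" if k: "k \<in> K" for k
  proof -
    have "(\<Sum>a\<in>S. cnj (f k a) * y a) = (\<Sum>a\<in>S. \<Sum>k'\<in>K. c k' * (cnj (f k a) * f k' a))"
      by (simp add: y_def sum_distrib_left mult.left_commute)
    also have "\<dots> = (\<Sum>k'\<in>K. \<Sum>a\<in>S. c k' * (cnj (f k a) * f k' a))"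
      by (rule sum.swap)
    also have "\<dots> = (\<Sum>k'\<in>K. c k' * (if k = k' then 1 else 0))"
      using orth[OF k] by (simp add: sum_distrib_left[symmetric])
    also have "\<dots> = c k" using K k by (simp add: if_distrib cong: if_cong)
    finally show ?thesis .
  qed
  have yy: "(\<Sum>a\<in>S. cnj (y a) * y a) = n"
  proof -
    have "(\<Sum>a\<in>S. cnj (y a) * y a) = (\<Sum>a\<in>S. \<Sum>k\<in>K. cnj (c k) * (cnj (f k a) * y a))"
      by (subst (1) y_def) (simp add: sum_distrib_right mult.assoc)
    also have "\<dots> = (\<Sum>k\<in>K. \<Sum>a\<in>S. cnj (c k) * (cnj (f k a) * y a))"
      by (rule sum.swap)
    also have "\<dots> = n"
      unfolding n_def by (intro sum.cong refl) (simp add: sum_distrib_left[symmetric] fy)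
    finally show ?thesis .
  qed
  have cn: "cnj n = n" by (simp add: n_def mult.commute)
  have xy: "(\<Sum>a\<in>S. cnj (x a) * y a) = n"
  proof -
    have "(\<Sum>a\<in>S. cnj (x a) * y a) = cnj (\<Sum>a\<in>S. cnj (y a) * x a)"
      by (simp add: mult.commute)
    thus ?thesis by (simp add: yx cn)
  qed
  have "complex_of_real (\<Sum>a\<in>S. (cmod (x a - y a))\<^sup>2)
      = (\<Sum>a\<in>S. cnj (x a) * x a - cnj (x a) * y a - cnj (y a) * x a + cnj (y a) * y a)"
    by (simp add: complex_norm_square algebra_simps flip: of_real_power)
  also have "\<dots> = (\<Sum>a\<in>S. cnj (x a) * x a) - n"
    by (simp add: sum.distrib sum_subtractf xy yx yy)
  also have "\<dots> = complex_of_real ((\<Sum>a\<in>S. (cmod (x a))\<^sup>2) - (\<Sum>k\<in>K. (cmod (c k))\<^sup>2))"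
    unfolding n_def by (simp add: complex_norm_square mult.commute flip: of_real_power)
  finally have "(\<Sum>a\<in>S. (cmod (x a - y a))\<^sup>2)
      = (\<Sum>a\<in>S. (cmod (x a))\<^sup>2) - (\<Sum>k\<in>K. (cmod (c k))\<^sup>2)"
    by (simp only: of_real_eq_iff)
  moreover have "0 \<le> (\<Sum>a\<in>S. (cmod (x a - y a))\<^sup>2)" by (simp add: sum_nonneg)
  ultimately show ?thesis by (simp add: c_def)
qed

section \<open>Entries of adjoints, products and diagonal matrices\<close>

lemma dim_mat_adjoint [simp]:
  "dim_row (mat_adjoint A) = dim_col A" "dim_col (mat_adjoint A) = dim_row A"
  by (simp_all add: mat_adjoint_def)

lemma mat_adjoint_carrier [simp, intro]:
  "A \<in> carrier_mat n m \<Longrightarrow> mat_adjoint A \<in> carrier_mat m n"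
  by auto

lemma index_mat_adjoint [simp]:
  fixes A :: "complex mat"
  shows "i < dim_col A \<Longrightarrow> j < dim_row A \<Longrightarrow> mat_adjoint A $$ (i, j) = cnj (A $$ (j, i))"
  by (simp add: mat_adjoint_def mat_of_rows_index)

text \<open>Keeps entries of products as plain sums. The simp rule \<open>index_mult_mat(1)\<close>
  would unfold them into scalar products of a row and a column, so it is removed from the simpset
  wherever this form or the entry itself has to survive.\<close>

lemma index_mult_mat_sum:
  assumes "dim_col A = dim_row B" "i < dim_row A" "j < dim_col B"
  shows "(A * B) $$ (i, j) = (\<Sum>k<dim_row B. A $$ (i, k) * B $$ (k, j))"
  using assms by (simp add: scalar_prod_def atLeast0LessThan)

lemma mat_adjoint_adjoint [simp]: "mat_adjoint (mat_adjoint A) = (A :: complex mat)"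
  by (rule eq_matI) simp_all

lemma mat_adjoint_mult:
  fixes A B :: "complex mat"
  assumes "dim_col A = dim_row B"
  shows "mat_adjoint (A * B) = mat_adjoint B * mat_adjoint A"
  by (rule eq_matI)
    (use assms in \<open>auto simp: index_mult_mat_sum mult.commute simp del: index_mult_mat(1)\<close>)

lemma mat_adjoint_one [simp]: "mat_adjoint (1\<^sub>m n) = (1\<^sub>m n :: complex mat)"
  by (rule eq_matI) auto

lemma mat_adjoint_four_block:
  fixes A B C D :: "complex mat"
  assumes "A \<in> carrier_mat r1 c1" "B \<in> carrier_mat r1 c2"
    "C \<in> carrier_mat r2 c1" "D \<in> carrier_mat r2 c2"
  shows "mat_adjoint (four_block_mat A B C D)
    = four_block_mat (mat_adjoint A) (mat_adjoint C) (mat_adjoint B) (mat_adjoint D)"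
  by (rule eq_matI) (use assms in auto)

lemma mat_adjoint_zero [simp]: "mat_adjoint (0\<^sub>m n m) = (0\<^sub>m m n :: complex mat)"
  by (rule eq_matI) auto

definition diag :: "nat \<Rightarrow> (nat \<Rightarrow> complex) \<Rightarrow> complex mat" where
  "diag n l = mat n n (\<lambda>(i, j). if i = j then l i else 0)"

lemma diag_carrier [simp, intro]: "diag n l \<in> carrier_mat n n"
  by (simp add: diag_def)

lemma dim_diag [simp]: "dim_row (diag n l) = n" "dim_col (diag n l) = n"
  by (simp_all add: diag_def)

lemma mult_diag_index:
  "A \<in> carrier_mat m n \<Longrightarrow> i < m \<Longrightarrow> j < n \<Longrightarrow> (A * diag n l) $$ (i, j) = A $$ (i, j) * l j"
  by (auto simp: index_mult_mat_sum diag_def if_distrib sum.delta cong: if_cong simp del: index_mult_mat(1))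

lemma adjoint_mult_index:
  fixes A B :: "complex mat"
  assumes "dim_row A = dim_row B" "i < dim_col A" "j < dim_col B"
  shows "(mat_adjoint A * B) $$ (i, j) = (\<Sum>k<dim_row B. cnj (A $$ (k, i)) * B $$ (k, j))"
  using assms by (simp add: index_mult_mat_sum del: index_mult_mat(1))

text \<open>Complete \<open>v\<close> to a basis, orthogonalize and normalize; Gram-Schmidt leaves
  the first vector alone. The factor \<open>c\<close> stays unspecified because an eigenvector
  equation is insensitive to scaling.\<close>

lemma unitary_with_first_col:
  fixes v :: "complex vec"
  assumes v: "v \<in> carrier_vec n" and v0: "v \<noteq> 0\<^sub>v n" and n: "0 < n"
  shows "\<exists>W c. W \<in> carrier_mat n n \<and> mat_adjoint W * W = 1\<^sub>m n \<and> col W 0 = c \<cdot>\<^sub>v v"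
proof -
  interpret cof_vec_space n "TYPE(complex)" .
  define b where "b = basis_completion v"
  define ws where "ws = gram_schmidt n b"
  from basis_completion[OF v v0, folded b_def]
  have dist_b: "distinct b" and indep: "\<not> lin_dep (set b)" and b: "set b \<subseteq> carrier_vec n"
    and hdb: "hd b = v" and len_b: "length b = n" by auto
  from hdb len_b n obtain vs where bv: "b = v # vs" by (cases b) auto
  from gram_schmidt_result[OF b dist_b indep refl, folded ws_def]
  have ws: "set ws \<subseteq> carrier_vec n" "corthogonal ws" "length ws = n"
    by (auto simp: len_b)
  from gram_schmidt_hd[OF v, of vs, folded bv] have hdws: "hd ws = v" unfolding ws_def .
  have wc: "ws ! j \<in> carrier_vec n" if "j < n" for j using ws that by auto
  define q where "q j = sqrt (\<Sum>a<n. (cmod (ws ! j $ a))\<^sup>2)" for j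
  have ip: "ws ! i \<bullet>c ws ! j = (\<Sum>a<n. ws ! i $ a * cnj (ws ! j $ a))" if "i < n" "j < n" for i j
    using wc[OF that(1)] wc[OF that(2)] by (auto simp: scalar_prod_def atLeast0LessThan)
  have q2: "complex_of_real (q j) * complex_of_real (q j) = (\<Sum>a<n. ws ! j $ a * cnj (ws ! j $ a))" for j
  proof -
    have "q j * q j = (\<Sum>a<n. (cmod (ws ! j $ a))\<^sup>2)"
      unfolding q_def by (simp add: sum_nonneg)
    thus ?thesis by (simp add: complex_norm_square flip: of_real_mult of_real_power)
  qed
  \<comment> \<open>\<open>corthogonal\<close> says that the product of two members vanishes exactly
    when their positions differ, so it also excludes zero vectors; dividing by the lengths
    \<open>q j\<close> is then legitimate.\<close>
  have q0: "q j \<noteq> 0" if "j < n" for j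
    using corthogonalD[OF ws(2), of j j] ip[OF that that] that ws(3) q2[of j] by auto
  define W where "W = mat n n (\<lambda>(a, j). ws ! j $ a / complex_of_real (q j))"
  have "mat_adjoint W * W = 1\<^sub>m n"
  proof (rule eq_matI)
    fix i j assume ij: "i < dim_row (1\<^sub>m n :: complex mat)" "j < dim_col (1\<^sub>m n :: complex mat)"
    have "(mat_adjoint W * W) $$ (i, j)
      = (\<Sum>a<n. cnj (ws ! i $ a) * ws ! j $ a) / complex_of_real (q i * q j)"
      using ij by (simp add: adjoint_mult_index W_def sum_divide_distrib del: index_mult_mat(1))
    also have "(\<Sum>a<n. cnj (ws ! i $ a) * ws ! j $ a) = ws ! j \<bullet>c ws ! i"
      using ij by (simp add: ip mult.commute)
    also have "\<dots> / complex_of_real (q i * q j) = 1\<^sub>m n $$ (i, j)"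
      using corthogonalD[OF ws(2), of j i] q2[of j] q0[of j] ij ip[of i i] ws(3) by auto
    finally show "(mat_adjoint W * W) $$ (i, j) = 1\<^sub>m n $$ (i, j)" .
  qed (auto simp: W_def)
  moreover have "col W 0 = (1 / complex_of_real (q 0)) \<cdot>\<^sub>v v"
  proof -
    have "ws ! 0 = v" using hdws ws(3) n by (cases ws) auto
    thus ?thesis using n v by (intro eq_vecI) (auto simp: W_def)
  qed
  moreover have "W \<in> carrier_mat n n" by (simp add: W_def)
  ultimately show ?thesis by blast
qed

section \<open>Spectral theorem\<close>

text \<open>\<open>case_nat e l\<close> puts a new eigenvalue \<open>e\<close> in front of the
  sequence \<open>l\<close>, which is the shape the induction on the dimension produces.\<close>

lemma diag_Suc:
  "diag (Suc n) (case_nat e l) = four_block_mat (diag 1 (\<lambda>_. e)) (0\<^sub>m 1 n) (0\<^sub>m n 1) (diag n l)"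
  by (rule eq_matI) (auto simp: diag_def split: nat.split)

text \<open>Deflation by induction on the dimension: conjugating \<open>A\<close> with a unitary
  whose first column is an eigenvector splits off a block of size 1, and the remaining block is
  again Hermitian. The values \<open>l\<close> are complex here; for
  \<open>mat_adjoint X * X\<close> they are later recognized as squared lengths.\<close>

lemma hermitian_spectral_decomposition:
  fixes A :: "complex mat"
  assumes "A \<in> carrier_mat n n" "mat_adjoint A = A"
  shows "\<exists>U l. U \<in> carrier_mat n n \<and> mat_adjoint U * U = 1\<^sub>m n \<and> A = U * diag n l * mat_adjoint U"
  using assms
proof (induction n arbitrary: A)
  case 0
  have "(1\<^sub>m 0 :: complex mat) \<in> carrier_mat 0 0" by simp
  moreover have "mat_adjoint (1\<^sub>m 0) * 1\<^sub>m 0 = (1\<^sub>m 0 :: complex mat)" by simp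
  moreover have "A = 1\<^sub>m 0 * diag 0 (\<lambda>_. 0) * mat_adjoint (1\<^sub>m 0)"
    by (rule eq_matI) (use 0 in auto)
  ultimately show ?case by blast
next
  case (Suc n)
  note A = Suc.prems(1) and herm = Suc.prems(2)
  from spectrum_non_empty[OF A] obtain e where "eigenvalue A e"
    by (auto simp: spectrum_def)
  then obtain v where v: "v \<in> carrier_vec (Suc n)" and v0: "v \<noteq> 0\<^sub>v (Suc n)"
    and ev: "A *\<^sub>v v = e \<cdot>\<^sub>v v"
    using A by (auto simp: eigenvalue_def eigenvector_def)
  from unitary_with_first_col[OF v v0] obtain W c
    where W: "W \<in> carrier_mat (Suc n) (Suc n)" and WW: "mat_adjoint W * W = 1\<^sub>m (Suc n)"
      and W0: "col W 0 = c \<cdot>\<^sub>v v" by auto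
  have W': "mat_adjoint W \<in> carrier_mat (Suc n) (Suc n)" using W by auto
  have WW': "W * mat_adjoint W = 1\<^sub>m (Suc n)"
    by (rule mat_mult_left_right_inverse[OF W' W WW])
  define M where "M = mat_adjoint W * (A * W)"
  have M: "M \<in> carrier_mat (Suc n) (Suc n)" using A W by (auto simp: M_def)
  have Mh: "mat_adjoint M = M"
    unfolding M_def using A W W' herm
    by (simp add: mat_adjoint_mult assoc_mult_mat[OF W' A W])
  have AM: "A = W * M * mat_adjoint W"
  proof -
    have AW: "A * W \<in> carrier_mat (Suc n) (Suc n)" using A W by auto
    have "W * M = (W * mat_adjoint W) * (A * W)"
      unfolding M_def using assoc_mult_mat[OF W W' AW] by simp
    hence "W * M = A * W" unfolding WW' left_mult_one_mat[OF AW] .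
    hence "W * M * mat_adjoint W = A * (W * mat_adjoint W)"
      using assoc_mult_mat[OF A W W'] by simp
    thus ?thesis using A WW' by simp
  qed
  \<comment> \<open>The first column of \<open>A * W\<close> is \<open>e\<close> times the first
    column of \<open>W\<close>, so the first column of \<open>M\<close> is \<open>e\<close> times
    that of \<open>mat_adjoint W * W\<close>, the identity.\<close>
  have M0: "M $$ (i, 0) = (if i = 0 then e else 0)" if i: "i < Suc n" for i
  proof -
    have "col (A * W) 0 = A *\<^sub>v col W 0" using A W by auto
    also have "\<dots> = e \<cdot>\<^sub>v col W 0"
      unfolding W0 using A v ev by (simp add: mult_mat_vec smult_smult_assoc mult.commute)
    finally have cAW: "col (A * W) 0 = e \<cdot>\<^sub>v col W 0" .
    have AW0: "(A * W) $$ (k, 0) = e * W $$ (k, 0)" if "k < Suc n" for k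
      using arg_cong[OF cAW, of "\<lambda>x. x $ k"] that A W by auto
    have "M $$ (i, 0) = (\<Sum>k<Suc n. cnj (W $$ (k, i)) * (A * W) $$ (k, 0))"
      unfolding M_def using A W i by (subst adjoint_mult_index) auto
    also have "\<dots> = (\<Sum>k<Suc n. cnj (W $$ (k, i)) * (e * W $$ (k, 0)))"
      by (intro sum.cong refl) (simp add: AW0 del: index_mult_mat(1))
    also have "\<dots> = e * (\<Sum>k<Suc n. cnj (W $$ (k, i)) * W $$ (k, 0))"
      unfolding sum_distrib_left by (intro sum.cong refl) simp
    also have "(\<Sum>k<Suc n. cnj (W $$ (k, i)) * W $$ (k, 0)) = (mat_adjoint W * W) $$ (i, 0)"
      using W i by (subst adjoint_mult_index) auto
    finally show ?thesis using i by (simp add: WW)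
  qed
  \<comment> \<open>Hermitian symmetry carries the vanishing from the first column to the first row,
    making \<open>M\<close> block diagonal.\<close>
  have M0': "M $$ (0, j) = (if j = 0 then e else 0)" if j: "j < Suc n" for j
  proof (cases "j = 0")
    case False
    have "M $$ (0, j) = mat_adjoint M $$ (0, j)" by (simp add: Mh)
    also have "\<dots> = cnj (M $$ (j, 0))" using M j by auto
    finally show ?thesis using M0[OF j] False by simp
  qed (simp add: M0)
  define B where "B = mat n n (\<lambda>(i, j). M $$ (Suc i, Suc j))"
  have B: "B \<in> carrier_mat n n" by (simp add: B_def)
  have Bh: "mat_adjoint B = B"
  proof (rule eq_matI)
    fix i j assume ij: "i < dim_row B" "j < dim_col B"
    have "cnj (M $$ (Suc j, Suc i)) = mat_adjoint M $$ (Suc i, Suc j)"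
      using M ij B by auto
    thus "mat_adjoint B $$ (i, j) = B $$ (i, j)" using ij by (simp add: Mh B_def)
  qed (auto simp: B_def)
  let ?bl = "\<lambda>X Y. four_block_mat X (0\<^sub>m 1 n) (0\<^sub>m n 1) Y :: complex mat"
  have MB: "M = ?bl (diag 1 (\<lambda>_. e)) B"
    by (rule eq_matI) (use M in \<open>auto simp: diag_def B_def M0 M0'\<close>)
  from Suc.IH[OF B Bh] obtain V l where V: "V \<in> carrier_mat n n"
    and VV: "mat_adjoint V * V = 1\<^sub>m n" and BV: "B = V * diag n l * mat_adjoint V" by blast
  have V': "mat_adjoint V \<in> carrier_mat n n" using V by auto
  \<comment> \<open>The unitary found for the small block, extended by 1 on the split-off
    eigenvector; \<open>W * Z\<close> then diagonalizes \<open>A\<close>.\<close>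
  define Z where "Z = ?bl (1\<^sub>m 1) V"
  have Z: "Z \<in> carrier_mat (Suc n) (Suc n)" using V by (auto simp: Z_def)
  have Z': "mat_adjoint Z = ?bl (1\<^sub>m 1) (mat_adjoint V)"
    unfolding Z_def using V by (subst mat_adjoint_four_block[where ?r1.0=1 and ?c1.0=1]) auto
  have Zc: "mat_adjoint Z \<in> carrier_mat (Suc n) (Suc n)" using Z by auto
  have bl_mult: "?bl X Y * ?bl X' Y' = ?bl (X * X') (Y * Y')"
    if "X \<in> carrier_mat 1 1" "X' \<in> carrier_mat 1 1" "Y \<in> carrier_mat n n" "Y' \<in> carrier_mat n n"
    for X X' Y Y'
    using that by (subst mult_four_block_mat[where ?nr1.0=1 and ?n1.0=1]) auto
  have ZZ: "mat_adjoint Z * Z = 1\<^sub>m (Suc n)"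
    unfolding Z' unfolding Z_def bl_mult[OF one_carrier_mat one_carrier_mat V' V] VV
    using four_block_one_mat[of 1 n, where 'a = complex] by simp
  have MZ: "M = Z * diag (Suc n) (case_nat e l) * mat_adjoint Z"
  proof -
    have "Z * diag (Suc n) (case_nat e l) = ?bl (diag 1 (\<lambda>_. e)) (V * diag n l)"
      unfolding Z_def diag_Suc bl_mult[OF one_carrier_mat diag_carrier V diag_carrier]
        left_mult_one_mat[OF diag_carrier] ..
    moreover have "?bl (diag 1 (\<lambda>_. e)) (V * diag n l) * mat_adjoint Z = M"
      unfolding Z' MB BV bl_mult[OF diag_carrier one_carrier_mat mult_carrier_mat[OF V diag_carrier] V']
        right_mult_one_mat[OF diag_carrier] ..
    ultimately show ?thesis by simp
  qed
  let ?D = "diag (Suc n) (case_nat e l)"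
  have D: "?D \<in> carrier_mat (Suc n) (Suc n)" by simp
  have U: "W * Z \<in> carrier_mat (Suc n) (Suc n)" using W Z by auto
  have Ua: "mat_adjoint (W * Z) = mat_adjoint Z * mat_adjoint W"
    using W Z by (simp add: mat_adjoint_mult)
  have "mat_adjoint (W * Z) * (W * Z) = mat_adjoint Z * ((mat_adjoint W * W) * Z)"
    unfolding Ua using assoc_mult_mat[OF Zc W' U] assoc_mult_mat[OF W' W Z] by simp
  hence UU: "mat_adjoint (W * Z) * (W * Z) = 1\<^sub>m (Suc n)"
    using WW Z ZZ by simp
  have "A = W * Z * ?D * mat_adjoint (W * Z)"
  proof -
    have ZD: "Z * ?D \<in> carrier_mat (Suc n) (Suc n)" using Z by auto
    have WZD: "W * Z * ?D \<in> carrier_mat (Suc n) (Suc n)" using U by auto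
    have "W * Z * ?D * mat_adjoint (W * Z) = (W * (Z * ?D)) * mat_adjoint Z * mat_adjoint W"
      unfolding Ua using assoc_mult_mat[OF WZD Zc W'] assoc_mult_mat[OF W Z D] by simp
    also have "\<dots> = W * M * mat_adjoint W"
      unfolding MZ using assoc_mult_mat[OF W ZD Zc] by simp
    finally show ?thesis using AM by simp
  qed
  with U UU show ?case by blast
qed

section \<open>Trace norm\<close>

text \<open>Uniqueness: if \<open>Y\<close> is a second root and \<open>S\<close> the diagonal matrix of the \<open>s k\<close>, then the
  columns \<open>w\<close> of \<open>Y * U - U * S\<close> satisfy \<open>Y w = - s k w\<close>, so positivity of \<open>Y\<close> forces \<open>w = 0\<close>.\<close>

lemma psd_sqrt_diagonalized:
  fixes U :: "complex mat" and s :: "nat \<Rightarrow> real"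
  assumes U: "U \<in> carrier_mat n n" and UU: "mat_adjoint U * U = 1\<^sub>m n"
    and s: "\<And>k. k < n \<Longrightarrow> 0 \<le> s k"
  shows "psd_sqrt (U * diag n (\<lambda>k. complex_of_real ((s k)\<^sup>2)) * mat_adjoint U)
    = U * diag n (\<lambda>k. complex_of_real (s k)) * mat_adjoint U"
proof -
  define S where "S = diag n (\<lambda>k. complex_of_real (s k))"
  define S2 where "S2 = diag n (\<lambda>k. complex_of_real ((s k)\<^sup>2))"
  have S: "S \<in> carrier_mat n n" and S2: "S2 \<in> carrier_mat n n" by (simp_all add: S_def S2_def)
  have SS: "S * S = S2"
  proof (rule eq_matI)
    fix i j assume "i < dim_row S2" "j < dim_col S2"
    hence "(S * S) $$ (i, j) = S $$ (i, j) * complex_of_real (s j)" "i < n" "j < n"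
      using mult_diag_index[OF S, of i j "\<lambda>k. complex_of_real (s k)"]
      by (simp_all add: S_def[symmetric] S2_def)
    thus "(S * S) $$ (i, j) = S2 $$ (i, j)"
      by (simp add: S_def S2_def diag_def power2_eq_square del: index_mult_mat(1))
  qed (use S S2 in auto)
  have Sh: "mat_adjoint S = S" by (rule eq_matI) (auto simp: S_def diag_def)
  have U': "mat_adjoint U \<in> carrier_mat n n" using U by auto
  have UU': "U * mat_adjoint U = 1\<^sub>m n" by (rule mat_mult_left_right_inverse[OF U' U UU])
  have US: "U * S \<in> carrier_mat n n" using U S by auto
  define P where "P = U * S * mat_adjoint U"
  define A where "A = U * S2 * mat_adjoint U"
  have P: "P \<in> carrier_mat n n" using U S by (auto simp: P_def)
  have A: "A \<in> carrier_mat n n" using U S2 by (auto simp: A_def)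
  have PU: "P * U = U * S"
    unfolding P_def using assoc_mult_mat[OF US U' U] right_mult_one_mat[OF US] by (simp add: UU)
  have AU: "A * U = U * S * S"
  proof -
    have "A * U = U * S2"
      unfolding A_def assoc_mult_mat[OF mult_carrier_mat[OF U S2] U' U] UU
      by (rule right_mult_one_mat[OF mult_carrier_mat[OF U S2]])
    thus ?thesis using assoc_mult_mat[OF U S S] by (simp add: SS)
  qed
  have PP: "P * P = A"
  proof -
    have "P * P = P * (U * S) * mat_adjoint U"
      by (subst (2) P_def) (use assoc_mult_mat[OF P US U'] in simp)
    also have "P * (U * S) = U * S2"
      using assoc_mult_mat[OF P U S] assoc_mult_mat[OF U S S] by (simp add: PU SS)
    finally show ?thesis by (simp add: A_def)
  qed
  have Ph: "mat_adjoint P = P"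
  proof -
    have "mat_adjoint P = U * mat_adjoint (U * S)"
      unfolding P_def using U S by (subst mat_adjoint_mult) auto
    also have "mat_adjoint (U * S) = S * mat_adjoint U"
      using U S by (subst mat_adjoint_mult) (auto simp: Sh)
    finally show ?thesis unfolding P_def using assoc_mult_mat[OF U S U'] by simp
  qed
  have Ppos: "0 \<le> Re (\<Sum>i<n. cnj (v $ i) * (P *\<^sub>v v) $ i)" if v: "v \<in> carrier_vec n" for v
  proof -
    \<comment> \<open>In the coordinates \<open>z\<close> with respect to the columns of
      \<open>U\<close>, the quadratic form of \<open>P\<close> is the sum of \<open>s k\<close>
      times the squared modulus of \<open>z $ k\<close>.\<close>
    define z where "z = mat_adjoint U *\<^sub>v v"
    have z: "z \<in> carrier_vec n" using U' v by (auto simp: z_def)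
    have Sz: "S *\<^sub>v z \<in> carrier_vec n" using S z by auto
    have Szk: "(S *\<^sub>v z) $ k = complex_of_real (s k) * z $ k" if k: "k < n" for k
      using k S z by (simp add: scalar_prod_def S_def diag_def if_distrib if_distribR sum.delta' cong: if_cong)
    have zk: "cnj (z $ k) = (\<Sum>i<n. cnj (v $ i) * U $$ (i, k))" if k: "k < n" for k
      using k U v by (simp add: z_def scalar_prod_def atLeast0LessThan mult.commute)
    have "P *\<^sub>v v = U *\<^sub>v (S *\<^sub>v z)"
      unfolding P_def z_def using assoc_mult_mat_vec[OF US U' v] assoc_mult_mat_vec[OF U S]
        U' v by simp
    hence "(P *\<^sub>v v) $ i = (\<Sum>k<n. U $$ (i, k) * (complex_of_real (s k) * z $ k))" if "i < n" for i
      using that U S z Szk by (simp add: scalar_prod_def atLeast0LessThan)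
    hence "(\<Sum>i<n. cnj (v $ i) * (P *\<^sub>v v) $ i)
        = (\<Sum>i<n. \<Sum>k<n. (cnj (v $ i) * U $$ (i, k)) * (complex_of_real (s k) * z $ k))"
      by (simp add: sum_distrib_left mult.assoc)
    also have "\<dots> = (\<Sum>k<n. cnj (z $ k) * (complex_of_real (s k) * z $ k))"
      by (subst sum.swap) (simp add: zk sum_distrib_right)
    also have "\<dots> = complex_of_real (\<Sum>k<n. s k * (cmod (z $ k))\<^sup>2)"
      by (simp add: complex_norm_square algebra_simps flip: of_real_power)
    finally have "Re (\<Sum>i<n. cnj (v $ i) * (P *\<^sub>v v) $ i) = (\<Sum>k<n. s k * (cmod (z $ k))\<^sup>2)"
      by (simp only: Re_complex_of_real)
    also have "0 \<le> \<dots>" using s by (intro sum_nonneg mult_nonneg_nonneg) auto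
    finally show ?thesis .
  qed
  have "psd_sqrt A = P"
    unfolding psd_sqrt_def
  proof (rule the_equality)
    show "P \<in> carrier_mat (dim_row A) (dim_row A) \<and> psd_mat P \<and> P * P = A"
      using P A PP Ph Ppos by (auto simp: psd_mat_def hermitian_mat_def)
  next
    fix Y assume "Y \<in> carrier_mat (dim_row A) (dim_row A) \<and> psd_mat Y \<and> Y * Y = A"
    hence Y: "Y \<in> carrier_mat n n" and Yp: "psd_mat Y" and YY: "Y * Y = A" using A by auto
    have Yh: "mat_adjoint Y = Y" using Yp by (simp add: psd_mat_def hermitian_mat_def)
    have YU: "Y * U \<in> carrier_mat n n" using Y U by auto
    \<comment> \<open>For a column \<open>u\<close> of \<open>U\<close>, both roots give
      \<open>Y (Y u) = s\<^sup>2 u\<close>, which factors as \<open>(Y + s) (Y - s) u = 0\<close>.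
      The columns of \<open>W\<close> are the inner factors \<open>(Y - s) u\<close>.\<close>
    define W where "W = Y * U - U * S"
    have W: "W \<in> carrier_mat n n" unfolding W_def by (rule minus_carrier_mat[OF US])
    have WS: "Y * W = - (W * S)"
    proof -
      have "Y * W = Y * (Y * U) - Y * (U * S)"
        unfolding W_def by (rule mult_minus_distrib_mat[OF Y YU US])
      also have "Y * (Y * U) = U * S * S" using assoc_mult_mat[OF Y Y U] by (simp add: YY AU)
      also have "Y * (U * S) = Y * U * S" using assoc_mult_mat[OF Y U S] by simp
      also have "U * S * S - Y * U * S = - (Y * U * S - U * S * S)"
        by (rule eq_matI) (use Y U S in auto)
      also have "Y * U * S - U * S * S = W * S"
        unfolding W_def by (rule minus_mult_distrib_mat[OF YU US S, symmetric])
      finally show ?thesis .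
    qed
    have YW: "(Y * W) $$ (i, k) = - (W $$ (i, k) * complex_of_real (s k))" if "i < n" "k < n" for i k
    proof -
      have "(W * S) $$ (i, k) = W $$ (i, k) * complex_of_real (s k)"
        unfolding S_def by (rule mult_diag_index[OF W that])
      thus ?thesis unfolding WS using that W S by (simp del: index_mult_mat(1))
    qed
    have W0: "(\<Sum>i<n. (cmod (W $$ (i, k)))\<^sup>2) = 0" if k: "k < n" for k
    proof (cases "s k = 0")
      \<comment> \<open>Positivity alone is inconclusive when \<open>s k = 0\<close>. Here the
        column is \<open>w = Y u\<close> with \<open>u\<close> the column of \<open>U\<close>, and
        \<open>Y w = 0\<close>; since \<open>Y\<close> is Hermitian, the squared length of
        \<open>w\<close> is the inner product of \<open>w\<close> with \<open>Y u\<close>, hence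
        that of \<open>Y w\<close> with \<open>u\<close>, which is 0.\<close>
      case True
      have YW0: "(Y * W) $$ (i, k) = 0" if "i < n" for i using YW[OF that k] True by simp
      have WYU: "W $$ (i, k) = (Y * U) $$ (i, k)" if i: "i < n" for i
      proof -
        have "(U * S) $$ (i, k) = 0"
          unfolding S_def by (subst mult_diag_index[OF U i k]) (simp add: True)
        thus ?thesis using i k Y U S by (simp add: W_def del: index_mult_mat(1))
      qed
      have "complex_of_real (\<Sum>i<n. (cmod (W $$ (i, k)))\<^sup>2) = (\<Sum>i<n. cnj (W $$ (i, k)) * (Y * U) $$ (i, k))"
        by (simp add: complex_norm_square WYU mult.commute del: index_mult_mat(1) flip: of_real_power)
      also have "\<dots> = (mat_adjoint W * (Y * U)) $$ (k, k)"
        using W Y U k by (subst adjoint_mult_index) auto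
      also have "mat_adjoint W * (Y * U) = mat_adjoint W * Y * U"
        using assoc_mult_mat[of "mat_adjoint W" n n Y n U n] W Y U by simp
      also have "mat_adjoint W * Y = mat_adjoint (Y * W)"
        using Y W by (subst mat_adjoint_mult) (auto simp: Yh)
      also have "(mat_adjoint (Y * W) * U) $$ (k, k) = (\<Sum>i<n. cnj ((Y * W) $$ (i, k)) * U $$ (i, k))"
        using Y W U k by (subst adjoint_mult_index) auto
      also have "\<dots> = 0" by (simp add: YW0 del: index_mult_mat(1))
      finally show ?thesis by (simp only: of_real_eq_0_iff)
    next
      case False
      have "col W k \<in> carrier_vec (dim_row Y)" "dim_row Y = n" using W Y by auto
      hence "0 \<le> Re (\<Sum>i<n. cnj (col W k $ i) * (Y *\<^sub>v col W k) $ i)"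
        using Yp unfolding psd_mat_def by metis
      also have "(\<Sum>i<n. cnj (col W k $ i) * (Y *\<^sub>v col W k) $ i)
          = (\<Sum>i<n. cnj (W $$ (i, k)) * (Y * W) $$ (i, k))"
        using W Y k by (intro sum.cong refl) auto
      also have "\<dots> = (\<Sum>i<n. - (complex_of_real (s k) * complex_of_real ((cmod (W $$ (i, k)))\<^sup>2)))"
        by (intro sum.cong refl, unfold complex_norm_square)
          (simp add: YW k del: index_mult_mat(1))
      also have "\<dots> = complex_of_real (- (s k * (\<Sum>i<n. (cmod (W $$ (i, k)))\<^sup>2)))"
        by (simp add: sum_negf sum_distrib_left)
      finally have "s k * (\<Sum>i<n. (cmod (W $$ (i, k)))\<^sup>2) \<le> 0" by (simp only: Re_complex_of_real)
      moreover have "0 < s k" using s[OF k] False by simp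
      ultimately have "(\<Sum>i<n. (cmod (W $$ (i, k)))\<^sup>2) \<le> 0" by (simp add: mult_le_0_iff)
      thus ?thesis by (simp add: sum_nonneg antisym)
    qed
    have Wz: "W $$ (i, k) = 0" if "i < n" "k < n" for i k
      using W0[OF that(2)] that(1) by (subst (asm) sum_nonneg_eq_0_iff) auto
    have "Y * U = U * S"
    proof (rule eq_matI)
      fix i j assume "i < dim_row (U * S)" "j < dim_col (U * S)"
      thus "(Y * U) $$ (i, j) = (U * S) $$ (i, j)"
        using Wz[of i j] U S Y by (simp add: W_def del: index_mult_mat(1))
    qed (use Y U S in auto)
    hence "Y * (U * mat_adjoint U) = P" using assoc_mult_mat[OF Y U U'] by (simp add: P_def)
    thus "Y = P" using Y by (simp add: UU')
  qed
  thus ?thesis by (simp add: A_def P_def S_def S2_def)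
qed

lemma mat_trace_diagonalized:
  assumes U: "U \<in> carrier_mat n n" and UU: "mat_adjoint U * U = 1\<^sub>m n"
  shows "mat_trace (U * diag n l * mat_adjoint U) = (\<Sum>k<n. l k)"
proof -
  have "mat_trace (U * diag n l * mat_adjoint U)
      = (\<Sum>i<n. \<Sum>k<n. (U * diag n l) $$ (i, k) * cnj (U $$ (i, k)))"
    unfolding mat_trace_def using U
    by (auto simp: index_mult_mat_sum simp del: index_mult_mat(1) intro!: sum.cong)
  also have "\<dots> = (\<Sum>i<n. \<Sum>k<n. l k * (cnj (U $$ (i, k)) * U $$ (i, k)))"
    by (intro sum.cong refl) (simp add: mult_diag_index[OF U] del: index_mult_mat(1))
  also have "\<dots> = (\<Sum>k<n. l k * (\<Sum>i<n. cnj (U $$ (i, k)) * U $$ (i, k)))"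
    by (subst sum.swap) (simp add: sum_distrib_left)
  also have "\<dots> = (\<Sum>k<n. l k * (mat_adjoint U * U) $$ (k, k))"
    using U by (intro sum.cong refl) (subst adjoint_mult_index, auto)
  finally show ?thesis by (simp add: UU)
qed

text \<open>The columns of \<open>X * U\<close> are the images under \<open>X\<close> of an orthonormal eigenbasis of
  \<open>X\<^sup>\<dagger>X\<close>; they are pairwise orthogonal and their lengths are the singular values of \<open>X\<close>.\<close>

lemma trace_norm_singular_values:
  fixes X :: "complex mat"
  assumes X: "X \<in> carrier_mat m n"
  shows "\<exists>U. U \<in> carrier_mat n n \<and> mat_adjoint U * U = 1\<^sub>m n \<and>
    (\<forall>k<n. \<forall>k'<n. k \<noteq> k' \<longrightarrow> (\<Sum>r<m. cnj ((X * U) $$ (r, k)) * (X * U) $$ (r, k')) = 0) \<and>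
    trace_norm X = (\<Sum>k<n. sqrt (\<Sum>r<m. (cmod ((X * U) $$ (r, k)))\<^sup>2))"
proof -
  let ?A = "mat_adjoint X * X"
  have X': "mat_adjoint X \<in> carrier_mat n m" using X by auto
  have A: "?A \<in> carrier_mat n n" using X by auto
  have "mat_adjoint ?A = ?A" using X by (subst mat_adjoint_mult) auto
  from hermitian_spectral_decomposition[OF A this] obtain U l
    where U: "U \<in> carrier_mat n n" and UU: "mat_adjoint U * U = 1\<^sub>m n"
      and AU: "?A = U * diag n l * mat_adjoint U" by blast
  have U': "mat_adjoint U \<in> carrier_mat n n" using U by auto
  have XU: "X * U \<in> carrier_mat m n" using X U by auto
  have UD: "U * diag n l \<in> carrier_mat n n" using U by auto
  have "mat_adjoint (X * U) * (X * U) = mat_adjoint U * (?A * U)"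
  proof -
    have "mat_adjoint (X * U) = mat_adjoint U * mat_adjoint X"
      using X U by (subst mat_adjoint_mult) auto
    thus ?thesis using assoc_mult_mat[OF U' X' XU] assoc_mult_mat[OF X' X U] by simp
  qed
  also have "?A * U = U * diag n l"
    unfolding AU using assoc_mult_mat[OF UD U' U] right_mult_one_mat[OF UD] by (simp add: UU)
  also have "mat_adjoint U * (U * diag n l) = diag n l"
    using assoc_mult_mat[OF U' U diag_carrier] left_mult_one_mat[OF diag_carrier] by (simp add: UU)
  finally have FF: "mat_adjoint (X * U) * (X * U) = diag n l" .
  have F: "(\<Sum>r<m. cnj ((X * U) $$ (r, k)) * (X * U) $$ (r, k')) = (if k = k' then l k else 0)"
    if k: "k < n" "k' < n" for k k'
  proof -
    have "(\<Sum>r<m. cnj ((X * U) $$ (r, k)) * (X * U) $$ (r, k')) = (mat_adjoint (X * U) * (X * U)) $$ (k, k')"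
      using XU k by (subst adjoint_mult_index) (auto simp del: index_mult_mat(1))
    thus ?thesis unfolding FF using k by (simp add: diag_def)
  qed
  define s where "s k = sqrt (\<Sum>r<m. (cmod ((X * U) $$ (r, k)))\<^sup>2)" for k
  have s0: "0 \<le> s k" for k by (simp add: s_def sum_nonneg)
  \<comment> \<open>The diagonal of \<open>FF\<close> consists of squared column lengths. This shows
    the complex \<open>l k\<close> to be squares of nonnegative reals, the form that
    \<open>psd_sqrt_diagonalized\<close> asks for.\<close>
  have sl: "complex_of_real ((s k)\<^sup>2) = l k" if "k < n" for k
  proof -
    have "complex_of_real ((s k)\<^sup>2) = (\<Sum>r<m. complex_of_real ((cmod ((X * U) $$ (r, k)))\<^sup>2))"
      by (simp add: s_def sum_nonneg)
    also have "\<dots> = l k"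
      unfolding complex_norm_square using F[OF that that] by (simp add: mult.commute)
    finally show ?thesis .
  qed
  have "diag n l = diag n (\<lambda>k. complex_of_real ((s k)\<^sup>2))"
    by (rule eq_matI) (auto simp: diag_def sl simp del: of_real_power)
  hence "psd_sqrt ?A = U * diag n (\<lambda>k. complex_of_real (s k)) * mat_adjoint U"
    unfolding AU by (simp add: psd_sqrt_diagonalized[OF U UU s0] del: of_real_power)
  hence "trace_norm X = (\<Sum>k<n. s k)"
    unfolding trace_norm_def by (simp add: mat_trace_diagonalized[OF U UU])
  thus ?thesis using U UU F unfolding s_def by auto
qed

lemma trace_norm_sum_rank_one_le:
  fixes X :: "complex mat" and u w :: "'j \<Rightarrow> nat \<Rightarrow> complex" and c :: "'j \<Rightarrow> real"
  assumes X: "X \<in> carrier_mat m n"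
    and c: "\<And>j. j \<in> J \<Longrightarrow> 0 \<le> c j"
    and Xe: "\<And>p q. p < m \<Longrightarrow> q < n \<Longrightarrow> X $$ (p, q) = (\<Sum>j\<in>J. complex_of_real (c j) * u j p * w j q)"
  shows "trace_norm X \<le> (\<Sum>j\<in>J. c j * (sqrt (\<Sum>p<m. (cmod (u j p))\<^sup>2) * sqrt (\<Sum>q<n. (cmod (w j q))\<^sup>2)))"
proof -
  from trace_norm_singular_values[OF X] obtain U
    where U: "U \<in> carrier_mat n n" and UU: "mat_adjoint U * U = 1\<^sub>m n"
      and orth: "\<And>k k'. k < n \<Longrightarrow> k' < n \<Longrightarrow> k \<noteq> k' \<Longrightarrow>
        (\<Sum>r<m. cnj ((X * U) $$ (r, k)) * (X * U) $$ (r, k')) = 0"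
      and tr: "trace_norm X = (\<Sum>k<n. sqrt (\<Sum>r<m. (cmod ((X * U) $$ (r, k)))\<^sup>2))" by blast
  define F where "F k r = (X * U) $$ (r, k)" for k r
  define s where "s k = sqrt (\<Sum>r<m. (cmod (F k r))\<^sup>2)" for k
  \<comment> \<open>Zero singular values must be left out: \<open>f k\<close> divides by
    \<open>s k\<close>, and with division by zero giving 0 it would not be a unit vector. They add
    nothing to the trace norm.\<close>
  define K where "K = {k. k < n \<and> s k \<noteq> 0}"
  define f where "f k r = F k r / complex_of_real (s k)" for k r
  define \<alpha> where "\<alpha> j k = (\<Sum>r<m. cnj (f k r) * u j r)" for j k
  \<comment> \<open>The rank-one terms pair \<open>w j\<close> with the columns of \<open>U\<close>
    without conjugation, whereas Bessel's inequality conjugates the family; the orthonormal family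
    is therefore the conjugated columns, which explains the double \<open>cnj\<close>.\<close>
  define \<beta> where "\<beta> j k = (\<Sum>q<n. cnj (cnj (U $$ (q, k))) * w j q)" for j k
  have K: "finite K" by (simp add: K_def)
  have FF: "(\<Sum>r<m. cnj (F k r) * F k r) = complex_of_real (s k) * complex_of_real (s k)" for k
  proof -
    have "(\<Sum>r<m. cnj (F k r) * F k r) = complex_of_real (\<Sum>r<m. (cmod (F k r))\<^sup>2)"
      by (simp add: complex_norm_square mult.commute flip: of_real_power)
    also have "(\<Sum>r<m. (cmod (F k r))\<^sup>2) = s k * s k" by (simp add: s_def sum_nonneg)
    finally show ?thesis by simp
  qed
  have forth: "(\<Sum>r<m. cnj (f k r) * f k' r) = (if k = k' then 1 else 0)"
    if "k \<in> K" "k' \<in> K" for k k'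
  proof -
    have "(\<Sum>r<m. cnj (f k r) * f k' r)
        = (\<Sum>r<m. cnj (F k r) * F k' r) / (complex_of_real (s k) * complex_of_real (s k'))"
      by (simp add: f_def sum_divide_distrib)
    thus ?thesis
      using FF[of k] orth[of k k'] that by (cases "k = k'") (auto simp: K_def F_def)
  qed
  have \<alpha>: "(\<Sum>k\<in>K. (cmod (\<alpha> j k))\<^sup>2) \<le> (\<Sum>p<m. (cmod (u j p))\<^sup>2)" for j
    unfolding \<alpha>_def by (rule bessel_inequality[OF K forth])
  have Uorth: "(\<Sum>q<n. cnj (cnj (U $$ (q, k))) * cnj (U $$ (q, k'))) = (if k = k' then 1 else 0)"
    if "k \<in> K" "k' \<in> K" for k k'
  proof -
    have "(\<Sum>q<n. cnj (cnj (U $$ (q, k))) * cnj (U $$ (q, k'))) = (mat_adjoint U * U) $$ (k', k)"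
      using U that by (subst adjoint_mult_index) (auto simp: K_def mult.commute)
    thus ?thesis using that by (auto simp: UU K_def)
  qed
  have \<beta>: "(\<Sum>k\<in>K. (cmod (\<beta> j k))\<^sup>2) \<le> (\<Sum>q<n. (cmod (w j q))\<^sup>2)" for j
    unfolding \<beta>_def by (rule bessel_inequality[OF K Uorth])
  have Fr: "F k r = (\<Sum>j\<in>J. complex_of_real (c j) * u j r * \<beta> j k)" if k: "k < n" and r: "r < m" for k r
  proof -
    have "F k r = (\<Sum>q<n. X $$ (r, q) * U $$ (q, k))"
      unfolding F_def using X U k r by (subst index_mult_mat_sum) auto
    also have "\<dots> = (\<Sum>q<n. \<Sum>j\<in>J. complex_of_real (c j) * u j r * (U $$ (q, k) * w j q))"
      using r by (intro sum.cong refl) (simp add: Xe sum_distrib_left sum_distrib_right mult_ac)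
    also have "\<dots> = (\<Sum>j\<in>J. complex_of_real (c j) * u j r * \<beta> j k)"
      by (subst sum.swap) (simp add: \<beta>_def sum_distrib_left)
    finally show ?thesis .
  qed
  \<comment> \<open>\<open>s k\<close> is the inner product of the unit vector \<open>f k\<close>
    with \<open>F k\<close>, the image under \<open>X\<close> of the right singular vector.
    Expanding \<open>X\<close> turns it into a sum of products of one left and one right
    coefficient.\<close>
  have sk: "s k \<le> (\<Sum>j\<in>J. c j * (cmod (\<alpha> j k) * cmod (\<beta> j k)))" if k: "k \<in> K" for k
  proof -
    have "complex_of_real (s k) = (\<Sum>r<m. cnj (f k r) * F k r)"
      using FF[of k] k by (simp add: f_def K_def flip: sum_divide_distrib)
    also have "\<dots> = (\<Sum>r<m. \<Sum>j\<in>J. complex_of_real (c j) * (cnj (f k r) * u j r) * \<beta> j k)"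
      using k by (intro sum.cong refl) (simp add: Fr K_def sum_distrib_left algebra_simps)
    also have "\<dots> = (\<Sum>j\<in>J. complex_of_real (c j) * \<alpha> j k * \<beta> j k)"
      by (subst sum.swap) (simp add: \<alpha>_def sum_distrib_left sum_distrib_right)
    finally have "complex_of_real (s k) = (\<Sum>j\<in>J. complex_of_real (c j) * \<alpha> j k * \<beta> j k)" .
    moreover have "s k = cmod (complex_of_real (s k))" by (simp add: s_def sum_nonneg)
    ultimately have "s k = cmod (\<Sum>j\<in>J. complex_of_real (c j) * \<alpha> j k * \<beta> j k)"
      by simp
    also have "\<dots> \<le> (\<Sum>j\<in>J. cmod (complex_of_real (c j) * \<alpha> j k * \<beta> j k))" by (rule norm_sum)
    also have "\<dots> = (\<Sum>j\<in>J. c j * (cmod (\<alpha> j k) * cmod (\<beta> j k)))"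
      by (intro sum.cong refl) (simp add: norm_mult c)
    finally show ?thesis .
  qed
  \<comment> \<open>Cauchy-Schwarz over \<open>k\<close> with \<open>j\<close> fixed; the two Bessel
    bounds then eliminate the singular vectors, which depend on the whole of
    \<open>X\<close>.\<close>
  have CS: "(\<Sum>k\<in>K. cmod (\<alpha> j k) * cmod (\<beta> j k))
      \<le> sqrt (\<Sum>p<m. (cmod (u j p))\<^sup>2) * sqrt (\<Sum>q<n. (cmod (w j q))\<^sup>2)" for j
  proof -
    have "(\<Sum>k\<in>K. cmod (\<alpha> j k) * cmod (\<beta> j k))
        \<le> sqrt (\<Sum>k\<in>K. (cmod (\<alpha> j k))\<^sup>2) * sqrt (\<Sum>k\<in>K. (cmod (\<beta> j k))\<^sup>2)"
      using L2_set_mult_ineq[of "\<lambda>k. cmod (\<alpha> j k)" "\<lambda>k. cmod (\<beta> j k)" K] by (simp add: L2_set_def)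
    also have "\<dots> \<le> sqrt (\<Sum>p<m. (cmod (u j p))\<^sup>2) * sqrt (\<Sum>q<n. (cmod (w j q))\<^sup>2)"
      using \<alpha>[of j] \<beta>[of j] by (intro mult_mono) (auto simp: sum_nonneg)
    finally show ?thesis .
  qed
  have "trace_norm X = (\<Sum>k<n. s k)" by (simp add: tr s_def F_def)
  also have "\<dots> = (\<Sum>k\<in>K. s k)" by (rule sum.mono_neutral_right) (auto simp: K_def)
  also have "\<dots> \<le> (\<Sum>k\<in>K. \<Sum>j\<in>J. c j * (cmod (\<alpha> j k) * cmod (\<beta> j k)))"
    by (rule sum_mono) (rule sk)
  also have "\<dots> = (\<Sum>j\<in>J. c j * (\<Sum>k\<in>K. cmod (\<alpha> j k) * cmod (\<beta> j k)))"
    by (subst sum.swap) (simp add: sum_distrib_left)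
  also have "\<dots> \<le> (\<Sum>j\<in>J. c j * (sqrt (\<Sum>p<m. (cmod (u j p))\<^sup>2) * sqrt (\<Sum>q<n. (cmod (w j q))\<^sup>2)))"
    by (intro sum_mono mult_left_mono CS c)
  finally show ?thesis .
qed

section \<open>Kronecker products and index maps\<close>

lemma mat_trace_mult:
  "A \<in> carrier_mat n n \<Longrightarrow> B \<in> carrier_mat n n \<Longrightarrow>
    mat_trace (A * B) = (\<Sum>a<n. \<Sum>b<n. A $$ (a, b) * B $$ (b, a))"
  by (auto simp: mat_trace_def scalar_prod_def atLeast0LessThan intro!: sum.cong)

text \<open>Splits an index of a Kronecker product into block and offset, matching the
  \<open>div\<close> and \<open>mod\<close> in \<open>kron\<close>; the trace of a product of
  Kronecker products factorizes through it.\<close>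

lemma sum_lessThan_mult:
  fixes f :: "nat \<Rightarrow> 'a :: comm_monoid_add"
  shows "(\<Sum>i<n * m. f i) = (\<Sum>a<n. \<Sum>b<m. f (a * m + b))"
proof -
  have "(\<Sum>i<n * m. f i) = (\<Sum>a<n. sum f {a * m..<a * m + m})"
    by (rule sum.nat_group[symmetric])
  moreover have "sum f {a * m..<a * m + m} = (\<Sum>b<m. f (a * m + b))" for a
    using sum.shift_bounds_nat_ivl[of f 0 "a * m" m] by (simp add: atLeast0LessThan add.commute)
  ultimately show ?thesis by simp
qed

lemma kron_carrier:
  "A \<in> carrier_mat n n \<Longrightarrow> B \<in> carrier_mat m m \<Longrightarrow> kron A B \<in> carrier_mat (n * m) (n * m)"
  by (auto simp: kron_def)

lemma index_kron:
  assumes "A \<in> carrier_mat n n" "B \<in> carrier_mat m m" "a < n" "a' < n" "b < m" "b' < m"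
  shows "kron A B $$ (a * m + b, a' * m + b') = A $$ (a, a') * B $$ (b, b')"
proof -
  have "x * m + y < n * m" if "x < n" "y < m" for x y
  proof -
    have "x * m + y < Suc x * m" using that by simp
    also have "\<dots> \<le> n * m" using that by (intro mult_right_mono) auto
    finally show ?thesis .
  qed
  thus ?thesis using assms by (auto simp: kron_def)
qed

lemma mat_trace_kron_mult:
  assumes A: "A \<in> carrier_mat n n" "A' \<in> carrier_mat n n"
    and B: "B \<in> carrier_mat m m" "B' \<in> carrier_mat m m"
  shows "mat_trace (kron A B * kron A' B') = mat_trace (A * A') * mat_trace (B * B')"
proof -
  have "mat_trace (kron A B * kron A' B')
      = (\<Sum>a<n. \<Sum>b<m. \<Sum>a'<n. \<Sum>b'<m. (A $$ (a, a') * A' $$ (a', a)) * (B $$ (b, b') * B' $$ (b', b)))"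
    unfolding mat_trace_mult[OF kron_carrier[OF A(1) B(1)] kron_carrier[OF A(2) B(2)]] sum_lessThan_mult
    by (intro sum.cong refl) (simp add: index_kron[OF A(1) B(1)] index_kron[OF A(2) B(2)])
  also have "\<dots> = (\<Sum>a<n. \<Sum>b<m. (\<Sum>a'<n. A $$ (a, a') * A' $$ (a', a)) * (\<Sum>b'<m. B $$ (b, b') * B' $$ (b', b)))"
    by (simp add: sum_product)
  also have "\<dots> = mat_trace (A * A') * mat_trace (B * B')"
    unfolding mat_trace_mult[OF A] mat_trace_mult[OF B] by (simp add: sum_product)
  finally show ?thesis .
qed

text \<open>The special clause for singletons agrees with the general one because the 1 by 1
  identity is neutral for \<open>kron\<close>; inductions on lists then need no singleton
  case.\<close>

lemma kron_list_Cons: "kron_list (A # As) = kron A (kron_list As)"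
  by (cases As) (auto intro!: eq_matI simp: kron_def)

lemma kron_list_carrier:
  assumes "\<And>l. l \<in> set ls \<Longrightarrow> A l \<in> carrier_mat (d l) (d l)"
  shows "kron_list (map A ls) \<in> carrier_mat (\<Prod>l\<leftarrow>ls. d l) (\<Prod>l\<leftarrow>ls. d l)"
  using assms
proof (induction ls)
  case (Cons l ls)
  thus ?case unfolding list.map kron_list_Cons prod_list.Cons by (intro kron_carrier) auto
qed simp

lemma mat_trace_kron_list_mult:
  assumes "\<And>l. l \<in> set ls \<Longrightarrow> A l \<in> carrier_mat (d l) (d l)"
    and "\<And>l. l \<in> set ls \<Longrightarrow> B l \<in> carrier_mat (d l) (d l)"
  shows "mat_trace (kron_list (map A ls) * kron_list (map B ls)) = (\<Prod>l\<leftarrow>ls. mat_trace (A l * B l))"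
  using assms
proof (induction ls)
  case Nil
  show ?case by (simp add: mat_trace_def)
next
  case (Cons l ls)
  show ?case unfolding list.map kron_list_Cons
    by (subst mat_trace_kron_mult[where n = "d l" and m = "\<Prod>l\<leftarrow>ls. d l"])
      (use Cons in \<open>auto intro!: kron_list_carrier\<close>)
qed

section \<open>Mixed-radix digits and bijectivity of the index maps\<close>

text \<open>The admissible subindices for a list of modes, with digits counted from 1 as in the
  tensor. A local dimension \<open>d = 1\<close> gives the radix 0 and hence no digit list at
  all.\<close>

definition digit_lists :: "nat list \<Rightarrow> nat list set" where
  "digit_lists Ds = {js. list_all2 (\<lambda>D j. 1 \<le> j \<and> j \<le> D) Ds js}"

lemma digit_lists_Nil [simp]: "digit_lists [] = {[]}"
  by (auto simp: digit_lists_def)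

lemma digit_lists_Cons: "digit_lists (D # Ds) = (\<lambda>(j, js). j # js) ` ({1..D} \<times> digit_lists Ds)"
  by (auto simp: digit_lists_def list_all2_Cons1)

lemma length_digit_lists: "js \<in> digit_lists Ds \<Longrightarrow> length js = length Ds"
  by (auto simp: digit_lists_def dest: list_all2_lengthD)

text \<open>The distributive law; it makes the squared norm of a product vector the product of the
  local squared norms.\<close>

lemma sum_digit_lists_prod:
  fixes g :: "'l \<Rightarrow> nat \<Rightarrow> 'a :: comm_semiring_1"
  shows "(\<Sum>js\<in>digit_lists (map D ls). prod_list (map2 g ls js)) = (\<Prod>l\<leftarrow>ls. \<Sum>j=1..D l. g l j)"
proof (induction ls)
  case (Cons l ls)
  have "inj_on (\<lambda>(j, js). j # js) ({1..D l} \<times> digit_lists (map D ls))"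
    by (auto simp: inj_on_def)
  hence "(\<Sum>js\<in>digit_lists (map D (l # ls)). prod_list (map2 g (l # ls) js))
      = (\<Sum>(j, js)\<in>{1..D l} \<times> digit_lists (map D ls). g l j * prod_list (map2 g ls js))"
    by (simp add: digit_lists_Cons sum.reindex case_prod_unfold)
  thus ?case
    using Cons by (simp add: sum.cartesian_product[symmetric] sum_product[symmetric])
qed simp

lemma card_digit_lists: "card (digit_lists Ds) = prod_list Ds"
proof (induction Ds)
  case (Cons D Ds)
  have "inj_on (\<lambda>(j, js). j # js) ({1..D} \<times> digit_lists Ds)"
    by (auto simp: inj_on_def)
  thus ?case using Cons by (simp add: digit_lists_Cons card_image card_cartesian_product)
qed simp

text \<open>The mixed-radix number with 1-based digits, most significant first. The recursion stands
  in for the nested sums and products of \<open>iota\<close>, which do not lend themselves to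
  induction.\<close>

fun positional_value :: "nat list \<Rightarrow> nat list \<Rightarrow> nat" where
  "positional_value (D # Ds) (j # js) = (j - 1) * prod_list Ds + positional_value Ds js"
| "positional_value _ _ = 0"

lemma positional_value_less: "js \<in> digit_lists Ds \<Longrightarrow> positional_value Ds js < prod_list Ds"
proof (induction Ds arbitrary: js)
  case (Cons D Ds)
  then obtain j js' where js: "js = j # js'" "1 \<le> j" "j \<le> D" "js' \<in> digit_lists Ds"
    by (auto simp: digit_lists_Cons)
  have "positional_value (D # Ds) js < (j - 1) * prod_list Ds + prod_list Ds"
    using Cons.IH[OF js(4)] js(1) by simp
  also have "\<dots> = j * prod_list Ds" using js(2) by (simp add: mult_eq_if)
  also have "\<dots> \<le> D * prod_list Ds" using js(3) by (rule mult_right_mono) simp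
  finally show ?case by simp
qed simp

text \<open>Uniqueness of quotient and remainder modulo \<open>P\<close>. It peels off a leading
  digit, and later separates the two digit blocks of \<open>iota\<close>.\<close>

lemma mult_add_less_eq_iff:
  fixes P :: nat
  assumes "x < P" "x' < P"
  shows "a * P + x = a' * P + x' \<longleftrightarrow> a = a' \<and> x = x'"
  by (metis assms add.commute div_mult_self3 div_less mod_mult_self3 mod_less add_0
      mod_mult_self2 add_left_cancel mult_cancel2 not_less0)

lemma positional_value_inj: "inj_on (positional_value Ds) (digit_lists Ds)"
proof (induction Ds)
  case (Cons D Ds)
  show ?case
  proof (rule inj_onI)
    fix js ks assume *: "js \<in> digit_lists (D # Ds)" "ks \<in> digit_lists (D # Ds)"
      "positional_value (D # Ds) js = positional_value (D # Ds) ks"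
    from * obtain j js' k ks' where j: "js = j # js'" "1 \<le> j" "js' \<in> digit_lists Ds"
      and k: "ks = k # ks'" "1 \<le> k" "ks' \<in> digit_lists Ds"
      by (auto simp: digit_lists_Cons)
    have "j - 1 = k - 1 \<and> positional_value Ds js' = positional_value Ds ks'"
      using *(3) mult_add_less_eq_iff[OF positional_value_less[OF j(3)] positional_value_less[OF k(3)]]
      by (simp add: j(1) k(1))
    thus "js = ks" using inj_onD[OF Cons.IH _ j(3) k(3)] j k by auto
  qed
qed simp

lemma positional_value_sum:
  "length js = length Ds \<Longrightarrow>
    positional_value Ds js = (\<Sum>s<length Ds. (js ! s - 1) * (\<Prod>t\<in>{Suc s..<length Ds}. Ds ! t))"
proof (induction Ds arbitrary: js)
  case (Cons D Ds)
  then obtain j js' where js: "js = j # js'" "length js' = length Ds" by (cases js) auto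
  have "(\<Prod>t\<in>{Suc 0..<Suc (length Ds)}. (D # Ds) ! t) = prod_list Ds"
    unfolding prod.shift_bounds_Suc_ivl by (simp add: prod.list_conv_set_nth)
  thus ?case
    unfolding js(1) positional_value.simps Cons.IH[OF js(2)] list.size add_Suc_right add_0_right
      sum.lessThan_Suc_shift prod.shift_bounds_Suc_ivl by simp
qed simp

text \<open>Both sums in \<open>iota\<close> have this form, with \<open>(a, b)\<close> being
  \<open>(n, k)\<close> and \<open>(0, n)\<close>: each is the value of a contiguous block of
  digits. The reindexing only moves between positions counted from 1 and list positions counted from
  0.\<close>

lemma iota_part_eq_positional_value:
  assumes "a \<le> b" "b \<le> length Ds" "length js = length Ds"
  shows "(\<Sum>s'\<in>{a+1..b}. (js ! (s' - 1) - 1) * (\<Prod>s''\<in>{s'+1..b}. Ds ! (s'' - 1)))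
    = positional_value (take (b - a) (drop a Ds)) (take (b - a) (drop a js))"
proof -
  have "positional_value (take (b - a) (drop a Ds)) (take (b - a) (drop a js))
      = (\<Sum>s<b - a. (js ! (a + s) - 1) * (\<Prod>t\<in>{Suc s..<b - a}. Ds ! (a + t)))"
    using assms by (subst positional_value_sum) (auto intro!: sum.cong prod.cong)
  also have "\<dots> = (\<Sum>s'\<in>{a+1..b}. (js ! (s' - 1) - 1) * (\<Prod>s''\<in>{s'+1..b}. Ds ! (s'' - 1)))"
  proof (rule sum.reindex_bij_witness[of _ "\<lambda>s'. s' - a - 1" "\<lambda>s. s + a + 1"])
    fix s assume s: "s \<in> {..<b - a}"
    have "(\<Prod>s''\<in>{s + a + 1 + 1..b}. Ds ! (s'' - 1)) = (\<Prod>t\<in>{Suc s..<b - a}. Ds ! (a + t))"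
      by (rule prod.reindex_bij_witness[of _ "\<lambda>t. t + a + 1" "\<lambda>t. t - a - 1"])
        (use s in \<open>auto simp: add.commute\<close>)
    thus "(js ! (s + a + 1 - 1) - 1) * (\<Prod>s''\<in>{s + a + 1 + 1..b}. Ds ! (s'' - 1))
      = (js ! (a + s) - 1) * (\<Prod>t\<in>{Suc s..<b - a}. Ds ! (a + t))"
      by (simp add: add.commute)
  qed auto
  finally show ?thesis by simp
qed

text \<open>Up to the final 1, \<open>iota n\<close> is the ordinary positional value of the
  cyclically rotated index: digits after position \<open>n\<close> become the leading ones.\<close>

lemma iota_eq_positional_value:
  assumes n: "n \<le> length Ds" and len: "length js = length Ds"
  shows "iota n Ds js = positional_value (drop n Ds) (drop n js) * prod_list (take n Ds)
    + positional_value (take n Ds) (take n js) + 1"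
proof -
  have "(\<Prod>s\<in>{1..n}. Ds ! (s - 1)) = (\<Prod>s\<in>{0..<n}. Ds ! s)"
    by (rule prod.reindex_bij_witness[of _ Suc "\<lambda>s. s - 1"]) auto
  also have "\<dots> = prod_list (take n Ds)"
    unfolding prod.list_conv_set_nth using n by (intro prod.cong) auto
  finally show ?thesis
    unfolding iota_def Let_def
    using iota_part_eq_positional_value[of n "length Ds" Ds js]
      iota_part_eq_positional_value[of 0 n Ds js] n len by (simp add: mult.commute)
qed

text \<open>The value of the first \<open>n\<close> digits stays below the product of their radices,
  so quotient and remainder recover both blocks. Surjectivity follows by counting. Subtracting 1
  turns the 1-based numbering into the 0-based positions of a matrix.\<close>

lemma bij_betw_iota:
  assumes n: "n \<le> length Ds"
  shows "bij_betw (\<lambda>js. iota n Ds js - 1) (digit_lists Ds) {..<prod_list Ds}"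
proof -
  let ?v = "\<lambda>js. positional_value (drop n Ds) (drop n js) * prod_list (take n Ds)
    + positional_value (take n Ds) (take n js)"
  have split: "take n js \<in> digit_lists (take n Ds)" "drop n js \<in> digit_lists (drop n Ds)"
    if "js \<in> digit_lists Ds" for js
    using that by (auto simp: digit_lists_def)
  have iv: "iota n Ds js - 1 = ?v js" if "js \<in> digit_lists Ds" for js
    using iota_eq_positional_value[OF n length_digit_lists[OF that]] by simp
  have inj: "inj_on (\<lambda>js. iota n Ds js - 1) (digit_lists Ds)"
  proof (rule inj_onI)
    fix js ks assume *: "js \<in> digit_lists Ds" "ks \<in> digit_lists Ds" "iota n Ds js - 1 = iota n Ds ks - 1"
    note js = split[OF *(1)] and ks = split[OF *(2)]
    have "positional_value (drop n Ds) (drop n js) = positional_value (drop n Ds) (drop n ks)"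
      "positional_value (take n Ds) (take n js) = positional_value (take n Ds) (take n ks)"
      using *(3)[unfolded iv[OF *(1)] iv[OF *(2)]]
        mult_add_less_eq_iff[OF positional_value_less[OF js(1)] positional_value_less[OF ks(1)]]
      by simp_all
    hence "drop n js = drop n ks" "take n js = take n ks"
      using inj_onD[OF positional_value_inj] js ks by blast+
    thus "js = ks" by (metis append_take_drop_id)
  qed
  have sub: "(\<lambda>js. iota n Ds js - 1) ` digit_lists Ds \<subseteq> {..<prod_list Ds}"
  proof safe
    fix js assume js: "js \<in> digit_lists Ds"
    have "?v js < Suc (positional_value (drop n Ds) (drop n js)) * prod_list (take n Ds)"
      using positional_value_less[OF split(1)[OF js]] by simp
    also have "\<dots> \<le> prod_list (drop n Ds) * prod_list (take n Ds)"
      using positional_value_less[OF split(2)[OF js]] by (intro mult_right_mono) auto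
    also have "\<dots> = prod_list Ds"
      by (metis append_take_drop_id mult.commute prod_list.append)
    finally show "iota n Ds js - 1 < prod_list Ds" unfolding iv[OF js] .
  qed
  have "(\<lambda>js. iota n Ds js - 1) ` digit_lists Ds = {..<prod_list Ds}"
    by (rule card_subset_eq[OF _ sub], simp) (simp only: card_image[OF inj] card_digit_lists card_lessThan)
  with inj show ?thesis by (simp add: bij_betw_def)
qed

section \<open>Unfoldings of the correlation tensor\<close>

text \<open>Glues a row subindex and a column subindex into one multi-index, which provides the
  witness needed for the \<open>SOME\<close> in \<open>mixed_unfolding\<close>.\<close>

lemma valid_index_with_lists:
  assumes rs: "distinct rs" "distinct cs" "set rs \<inter> set cs = {}" "set rs \<union> set cs = {1..N}"
    and js: "js \<in> digit_lists (map D rs)" and ks: "ks \<in> digit_lists (map D cs)"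
  shows "\<exists>i. valid_index N D i \<and> map i rs = js \<and> map i cs = ks"
proof -
  \<comment> \<open>The last branch is 0 because \<open>valid_index\<close> prescribes that value
    outside \<open>{1..N}\<close>.\<close>
  define i where "i l = (if l \<in> set rs then the (map_of (zip rs js) l)
    else if l \<in> set cs then the (map_of (zip cs ks) l) else 0)" for l
  have len: "length js = length rs" "length ks = length cs"
    using length_digit_lists[OF js] length_digit_lists[OF ks] by simp_all
  have ir: "i (rs ! s) = js ! s" if "s < length rs" for s
    using that rs(1) len by (simp add: i_def map_of_zip_nth)
  have ic: "i (cs ! s) = ks ! s" if "s < length cs" for s
  proof -
    have "cs ! s \<notin> set rs" using rs(3) that by (meson disjoint_iff nth_mem)
    thus ?thesis using that rs(2) len by (simp add: i_def map_of_zip_nth)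
  qed
  have mr: "map i rs = js" by (rule nth_equalityI) (simp_all add: len ir)
  have mc: "map i cs = ks" by (rule nth_equalityI) (simp_all add: len ic)
  have "1 \<le> i l \<and> i l \<le> D l" if "l \<in> {1..N}" for l
  proof -
    from that have "l \<in> set rs \<union> set cs" unfolding rs(4) .
    then consider "l \<in> set rs" | "l \<in> set cs" by blast
    thus ?thesis
    proof cases
      case 1
      then obtain s where s: "s < length rs" "l = rs ! s" by (auto simp: in_set_conv_nth)
      hence "1 \<le> js ! s \<and> js ! s \<le> D (rs ! s)"
        using js by (simp add: digit_lists_def list_all2_conv_all_nth)
      thus ?thesis using ir s by simp
    next
      case 2
      then obtain s where s: "s < length cs" "l = cs ! s" by (auto simp: in_set_conv_nth)
      hence "1 \<le> ks ! s \<and> ks ! s \<le> D (cs ! s)"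
        using ks by (simp add: digit_lists_def list_all2_conv_all_nth)
      thus ?thesis using ic s by simp
    qed
  qed
  moreover have "i l = 0" if "l \<notin> {1..N}" for l
    using that unfolding rs(4)[symmetric] by (simp add: i_def)
  ultimately show ?thesis using mr mc unfolding valid_index_def by blast
qed

lemma map_valid_index_in_digit_lists:
  assumes "valid_index N D i" "set ls \<subseteq> {1..N}"
  shows "map i ls \<in> digit_lists (map D ls)"
  using assms by (auto simp: digit_lists_def list_all2_conv_all_nth valid_index_def subset_iff)

text \<open>In a product tensor the factors with mode in \<open>R\<close> depend on the row only and
  the others on the column only, so each term unfolds to a rank-one matrix. The resulting bound no
  longer involves \<open>R\<close>, \<open>n\<close> or \<open>m\<close>.\<close>

lemma trace_norm_mixed_unfolding_le:
  fixes t :: "'j \<Rightarrow> nat \<Rightarrow> nat \<Rightarrow> complex" and c :: "'j \<Rightarrow> real"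
  assumes c: "\<And>j. j \<in> J \<Longrightarrow> 0 \<le> c j"
    and A: "\<And>i. valid_index N D i \<Longrightarrow> A i = (\<Sum>j\<in>J. complex_of_real (c j) * (\<Prod>l=1..N. t j l (i l)))"
    and R: "R \<subseteq> {1..N}" and n: "n \<le> card R" and m: "m \<le> N - card R"
  shows "trace_norm (mixed_unfolding N D A R n m)
    \<le> (\<Sum>j\<in>J. c j * (\<Prod>l=1..N. sqrt (\<Sum>x=1..D l. (cmod (t j l x))\<^sup>2)))"
proof -
  define rs where "rs = sorted_list_of_set R"
  define cs where "cs = sorted_list_of_set ({1..N} - R)"
  have fin: "finite R" "finite ({1..N} - R)" using R finite_subset by auto
  have rs: "set rs = R" "distinct rs" "length rs = card R"
    using fin by (simp_all add: rs_def)
  have cs: "set cs = {1..N} - R" "distinct cs" "length cs = N - card R"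
    using fin R by (simp_all add: cs_def card_Diff_subset)
  let ?DR = "map D rs" and ?DC = "map D cs"
  have bijR: "bij_betw (\<lambda>js. iota n ?DR js - 1) (digit_lists ?DR) {..<prod_list ?DR}"
    by (rule bij_betw_iota) (use n rs in simp)
  have bijC: "bij_betw (\<lambda>js. iota m ?DC js - 1) (digit_lists ?DC) {..<prod_list ?DC}"
    by (rule bij_betw_iota) (use m cs in simp)
  \<comment> \<open>\<open>fR\<close> and \<open>fC\<close> decode row and column numbers into digit
    lists, so that the product vectors \<open>u\<close> and \<open>w\<close> can be written as
    functions of matrix positions.\<close>
  define fR where "fR = the_inv_into (digit_lists ?DR) (\<lambda>js. iota n ?DR js - 1)"
  define fC where "fC = the_inv_into (digit_lists ?DC) (\<lambda>js. iota m ?DC js - 1)"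
  have fR: "fR (iota n ?DR js - 1) = js" if "js \<in> digit_lists ?DR" for js
    unfolding fR_def using the_inv_into_f_f[OF bij_betw_imp_inj_on[OF bijR] that] .
  have fC: "fC (iota m ?DC js - 1) = js" if "js \<in> digit_lists ?DC" for js
    unfolding fC_def using the_inv_into_f_f[OF bij_betw_imp_inj_on[OF bijC] that] .
  have iota_pos: "iota k Ds js = Suc (iota k Ds js - 1)" for k Ds js
    by (simp add: iota_def Let_def)
  define u where "u j p = prod_list (map2 (t j) rs (fR p))" for j p
  define w where "w j q = prod_list (map2 (t j) cs (fC q))" for j q
  let ?X = "mixed_unfolding N D A R n m"
  have X: "?X \<in> carrier_mat (prod_list ?DR) (prod_list ?DC)"
    by (simp add: mixed_unfolding_def Let_def rs_def cs_def)
  have map2_map: "prod_list (map2 (t j) ls (map i ls)) = (\<Prod>l\<leftarrow>ls. t j l (i l))" for j i ls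
    by (induction ls) auto
  have Xe: "?X $$ (p, q) = (\<Sum>j\<in>J. complex_of_real (c j) * u j p * w j q)"
    if p: "p < prod_list ?DR" and q: "q < prod_list ?DC" for p q
  proof -
    define Q where "Q i \<longleftrightarrow> valid_index N D i \<and> iota n ?DR (map i rs) = p + 1
      \<and> iota m ?DC (map i cs) = q + 1" for i
    have "\<exists>i. Q i"
    proof -
      have "p \<in> (\<lambda>js. iota n ?DR js - 1) ` digit_lists ?DR"
        unfolding bij_betw_imp_surj_on[OF bijR] using p by simp
      then obtain js where js: "js \<in> digit_lists ?DR" "iota n ?DR js - 1 = p" by blast
      have "q \<in> (\<lambda>js. iota m ?DC js - 1) ` digit_lists ?DC"
        unfolding bij_betw_imp_surj_on[OF bijC] using q by simp
      then obtain ks where ks: "ks \<in> digit_lists ?DC" "iota m ?DC ks - 1 = q" by blast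
      have "\<exists>i. valid_index N D i \<and> map i rs = js \<and> map i cs = ks"
        using rs cs R js ks by (intro valid_index_with_lists) auto
      thus ?thesis unfolding Q_def using js(2) ks(2) iota_pos by (metis Suc_eq_plus1)
    qed
    \<comment> \<open>Whichever index \<open>SOME\<close> selects, injectivity of the index maps
      forces its digits on \<open>rs\<close> and \<open>cs\<close> to be the decoded ones.\<close>
    define i where "i = (SOME i. Q i)"
    have Qi: "Q i" unfolding i_def using \<open>\<exists>i. Q i\<close> by (rule someI_ex)
    have "map i rs \<in> digit_lists ?DR" "map i cs \<in> digit_lists ?DC"
      using Qi rs cs R by (auto simp: Q_def intro!: map_valid_index_in_digit_lists)
    hence "fR p = map i rs" "fC q = map i cs"
      using fR[of "map i rs"] fC[of "map i cs"] Qi by (simp_all add: Q_def)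
    hence uw: "u j p * w j q = (\<Prod>l=1..N. t j l (i l))" for j
    proof -
      have "(\<Prod>l=1..N. t j l (i l)) = (\<Prod>l\<in>{1..N} - R. t j l (i l)) * (\<Prod>l\<in>R. t j l (i l))"
        using prod.subset_diff[OF R] by simp
      thus ?thesis
        using prod.distinct_set_conv_list[OF rs(2), of "\<lambda>l. t j l (i l)"]
          prod.distinct_set_conv_list[OF cs(2), of "\<lambda>l. t j l (i l)"] rs(1) cs(1)
          \<open>fR p = map i rs\<close> \<open>fC q = map i cs\<close>
        by (simp add: u_def w_def map2_map)
    qed
    have "?X $$ (p, q) = A i"
      using p q by (simp add: mixed_unfolding_def Let_def i_def Q_def rs_def cs_def)
    also have "\<dots> = (\<Sum>j\<in>J. complex_of_real (c j) * (u j p * w j q))"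
      using A[of i] Qi by (simp add: Q_def uw)
    finally show ?thesis by (simp add: mult.assoc)
  qed
  have norm_map2: "(cmod (prod_list (map2 (t j) ls js)))\<^sup>2
      = prod_list (map2 (\<lambda>l x. (cmod (t j l x))\<^sup>2) ls js)" for j ls js
    by (induction ls arbitrary: js)
      (auto simp: norm_mult power_mult_distrib split: list.split simp: zip_Cons1)
  \<comment> \<open>Summing over rows amounts to summing over digit lists by bijectivity, and that
    sum factorizes over the modes.\<close>
  have su: "(\<Sum>p<prod_list ?DR. (cmod (u j p))\<^sup>2) = (\<Prod>l\<in>R. \<Sum>x=1..D l. (cmod (t j l x))\<^sup>2)" for j
  proof -
    have "(\<Sum>p<prod_list ?DR. (cmod (u j p))\<^sup>2)
        = (\<Sum>js\<in>digit_lists ?DR. (cmod (u j (iota n ?DR js - 1)))\<^sup>2)"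
      by (rule sum.reindex_bij_betw[OF bijR, symmetric])
    also have "\<dots> = (\<Sum>js\<in>digit_lists ?DR. prod_list (map2 (\<lambda>l x. (cmod (t j l x))\<^sup>2) rs js))"
      unfolding u_def by (intro sum.cong refl) (simp only: fR norm_map2)
    finally show ?thesis
      unfolding sum_digit_lists_prod
      using prod.distinct_set_conv_list[OF rs(2), of "\<lambda>l. \<Sum>x=1..D l. (cmod (t j l x))\<^sup>2"] rs(1) by simp
  qed
  have sw: "(\<Sum>q<prod_list ?DC. (cmod (w j q))\<^sup>2) = (\<Prod>l\<in>{1..N} - R. \<Sum>x=1..D l. (cmod (t j l x))\<^sup>2)" for j
  proof -
    have "(\<Sum>q<prod_list ?DC. (cmod (w j q))\<^sup>2)
        = (\<Sum>js\<in>digit_lists ?DC. (cmod (w j (iota m ?DC js - 1)))\<^sup>2)"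
      by (rule sum.reindex_bij_betw[OF bijC, symmetric])
    also have "\<dots> = (\<Sum>js\<in>digit_lists ?DC. prod_list (map2 (\<lambda>l x. (cmod (t j l x))\<^sup>2) cs js))"
      unfolding w_def by (intro sum.cong refl) (simp only: fC norm_map2)
    finally show ?thesis
      unfolding sum_digit_lists_prod
      using prod.distinct_set_conv_list[OF cs(2), of "\<lambda>l. \<Sum>x=1..D l. (cmod (t j l x))\<^sup>2"] cs(1) by simp
  qed
  have sqrt_prod: "sqrt (\<Prod>l\<in>S. f l) = (\<Prod>l\<in>S. sqrt (f l))" for S and f :: "nat \<Rightarrow> real"
    by (induction S rule: infinite_finite_induct) (auto simp: real_sqrt_mult)
  have "trace_norm ?X \<le> (\<Sum>j\<in>J. c j * (sqrt (\<Sum>p<prod_list ?DR. (cmod (u j p))\<^sup>2)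
      * sqrt (\<Sum>q<prod_list ?DC. (cmod (w j q))\<^sup>2)))"
    by (rule trace_norm_sum_rank_one_le[OF X c Xe])
  also have "\<dots> = (\<Sum>j\<in>J. c j * (\<Prod>l=1..N. sqrt (\<Sum>x=1..D l. (cmod (t j l x))\<^sup>2)))"
    unfolding su sw sqrt_prod prod.subset_diff[OF R finite_atLeastAtMost]
    by (simp add: mult.commute)
  finally show ?thesis .
qed

text \<open>Bessel's inequality for the traceless part \<open>\<sigma> - I/d\<close>, whose squared Hilbert-Schmidt
  norm is \<open>1 - 1/d\<close>.\<close>

lemma pure_state_coefficients_le:
  fixes \<kappa> :: real and G :: "nat \<Rightarrow> complex mat"
  assumes d: "1 \<le> d" and \<kappa>: "0 < \<kappa>" and fin: "finite I"
    and Gcar: "\<And>i. i \<in> I \<Longrightarrow> G i \<in> carrier_mat d d"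
    and Gtr: "\<And>i. i \<in> I \<Longrightarrow> mat_trace (G i) = 0"
    and Gorth: "\<And>i i'. i \<in> I \<Longrightarrow> i' \<in> I \<Longrightarrow>
      mat_trace (mat_adjoint (G i) * G i') = (if i = i' then complex_of_real \<kappa> else 0)"
    and \<sigma>: "pure_state d \<sigma>"
  shows "(\<Sum>i\<in>I. (cmod (mat_trace (\<sigma> * G i)))\<^sup>2) \<le> \<kappa> * (1 - 1 / real d)"
proof -
  from \<sigma> obtain v where v1: "(\<Sum>a<d. (cmod (v $ a))\<^sup>2) = 1"
    and \<sigma>v: "\<sigma> = mat d d (\<lambda>(a, b). v $ a * cnj (v $ b))"
    by (auto simp: pure_state_def)
  have \<sigma>c: "\<sigma> \<in> carrier_mat d d" by (simp add: \<sigma>v)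
  define k where "k = complex_of_real (sqrt \<kappa>)"
  have k: "k * k = complex_of_real \<kappa>" "k \<noteq> 0" "cnj k = k"
    using \<kappa> by (simp_all add: k_def flip: of_real_mult)
  let ?S = "{..<d} \<times> {..<d}"
  \<comment> \<open>The adjoint of \<open>G i\<close>, scaled to unit length and read as a vector
    over pairs: the Bessel coefficient of a matrix then becomes its trace against
    \<open>G i\<close>, divided by \<open>k\<close>.\<close>
  define f where "f i = (\<lambda>(a, b). cnj (G i $$ (b, a)) / k)" for i
  \<comment> \<open>Removing \<open>I/d\<close> leaves the coefficients unchanged because the
    \<open>G i\<close> are traceless, but lowers the squared norm from 1 to
    \<open>1 - 1/d\<close>.\<close>
  define x where "x = (\<lambda>(a, b). \<sigma> $$ (a, b) - (if a = b then 1 / of_nat d else 0))"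
  have pair: "(\<Sum>z\<in>?S. g z) = (\<Sum>a<d. \<Sum>b<d. g (a, b))" for g :: "nat \<times> nat \<Rightarrow> 'b :: comm_monoid_add"
    by (simp add: sum.cartesian_product)
  have orth: "(\<Sum>z\<in>?S. cnj (f i z) * f i' z) = (if i = i' then 1 else 0)" if i: "i \<in> I" "i' \<in> I" for i i'
  proof -
    have "(\<Sum>z\<in>?S. cnj (f i z) * f i' z) = (\<Sum>a<d. \<Sum>b<d. cnj (G i' $$ (b, a)) * G i $$ (b, a)) / (k * k)"
      by (simp add: pair f_def k sum_divide_distrib mult.commute)
    also have "(\<Sum>a<d. \<Sum>b<d. cnj (G i' $$ (b, a)) * G i $$ (b, a)) = mat_trace (mat_adjoint (G i') * G i)"
      using Gcar[OF i(1)] Gcar[OF i(2)]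
      by (subst mat_trace_mult[of _ d]) (auto intro!: sum.cong)
    finally show ?thesis using Gorth[OF i(2,1)] k \<kappa> by auto
  qed
  have coef: "(\<Sum>z\<in>?S. cnj (f i z) * x z) = mat_trace (\<sigma> * G i) / k" if i: "i \<in> I" for i
  proof -
    have "(\<Sum>z\<in>?S. cnj (f i z) * x z)
        = ((\<Sum>a<d. \<Sum>b<d. \<sigma> $$ (a, b) * G i $$ (b, a))
          - (\<Sum>a<d. \<Sum>b<d. if a = b then G i $$ (b, a) / of_nat d else 0)) / k"
      unfolding pair sum_subtractf[symmetric] sum_divide_distrib
      by (intro sum.cong refl) (simp add: f_def x_def k field_simps)
    also have "(\<Sum>a<d. \<Sum>b<d. if a = b then G i $$ (b, a) / of_nat d else 0) = mat_trace (G i) / of_nat d"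
      using Gcar[OF i] by (simp add: mat_trace_def sum_divide_distrib)
    finally show ?thesis using Gtr[OF i] mat_trace_mult[OF \<sigma>c Gcar[OF i]] by simp
  qed
  have v1c: "(\<Sum>a<d. v $ a * cnj (v $ a)) = 1"
  proof -
    have "(\<Sum>a<d. v $ a * cnj (v $ a)) = complex_of_real (\<Sum>a<d. (cmod (v $ a))\<^sup>2)"
      by (simp add: complex_norm_square flip: of_real_power)
    thus ?thesis by (simp add: v1)
  qed
  have nx: "(\<Sum>z\<in>?S. (cmod (x z))\<^sup>2) = 1 - 1 / real d"
  proof -
    have "complex_of_real (\<Sum>z\<in>?S. (cmod (x z))\<^sup>2) = (\<Sum>z\<in>?S. x z * cnj (x z))"
      by (simp add: complex_norm_square flip: of_real_power)
    also have "\<dots> = (\<Sum>a<d. \<Sum>b<d. (v $ a * cnj (v $ a)) * (v $ b * cnj (v $ b))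
        - (if a = b then 2 * (v $ a * cnj (v $ a)) / of_nat d - 1 / (of_nat d * of_nat d) else 0))"
      unfolding pair by (intro sum.cong refl) (auto simp: x_def \<sigma>v field_simps)
    also have "\<dots> = (\<Sum>a<d. v $ a * cnj (v $ a)) * (\<Sum>b<d. v $ b * cnj (v $ b))
        - (\<Sum>a<d. 2 * (v $ a * cnj (v $ a)) / of_nat d - 1 / (of_nat d * of_nat d))"
      by (simp add: sum_subtractf sum_product)
    also have "(\<Sum>a<d. 2 * (v $ a * cnj (v $ a)) / of_nat d - 1 / (of_nat d * of_nat d))
        = 2 * (\<Sum>a<d. v $ a * cnj (v $ a)) / of_nat d - of_nat d * (1 / (of_nat d * of_nat d))"
      by (simp add: sum_subtractf sum_distrib_left sum_divide_distrib)
    also have "(\<Sum>a<d. v $ a * cnj (v $ a)) * (\<Sum>b<d. v $ b * cnj (v $ b)) - \<dots>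
        = complex_of_real (1 - 1 / real d)"
      unfolding v1c using d by (simp add: field_simps)
    finally show ?thesis by (simp only: of_real_eq_iff)
  qed
  have "(\<Sum>i\<in>I. (cmod (mat_trace (\<sigma> * G i) / k))\<^sup>2) \<le> 1 - 1 / real d"
    using bessel_inequality[OF fin orth, of x] by (simp add: coef nx)
  moreover have "(cmod (z / k))\<^sup>2 = (cmod z)\<^sup>2 / \<kappa>" for z
    using \<kappa> by (simp add: k_def norm_divide power_divide)
  ultimately show ?thesis
    using \<kappa> by (simp add: sum_divide_distrib[symmetric] pos_divide_le_eq mult.commute)
qed

theorem theorem6:
  fixes N :: nat and d :: "nat \<Rightarrow> nat" and \<kappa> :: "nat \<Rightarrow> real"
    and G :: "nat \<Rightarrow> nat \<Rightarrow> complex mat" and \<rho> :: "complex mat"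
  assumes N2: "N \<ge> 2"
    and dpos: "\<forall>l\<in>{1..N}. 1 \<le> d l"
    and kappa: "\<forall>l\<in>{1..N}. 1 \<le> \<kappa> l"
    and Gcar: "\<forall>l\<in>{1..N}. \<forall>i<(d l)\<^sup>2. G l i \<in> carrier_mat (d l) (d l)"
    and G0: "\<forall>l\<in>{1..N}. G l 0 = 1\<^sub>m (d l)"
    and Gbasis: "\<forall>l\<in>{1..N}. \<forall>X \<in> carrier_mat (d l) (d l).
                   \<exists>c :: nat \<Rightarrow> complex. \<forall>a<d l. \<forall>b<d l.
                     X $$ (a, b) = (\<Sum>i<(d l)\<^sup>2. c i * G l i $$ (a, b))"
    and Gtr: "\<forall>l\<in>{1..N}. \<forall>i. 1 \<le> i \<and> i < (d l)\<^sup>2 \<longrightarrow> mat_trace (G l i) = 0"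
    and Gorth: "\<forall>l\<in>{1..N}. \<forall>i i'. 1 \<le> i \<and> i < (d l)\<^sup>2 \<and> 1 \<le> i' \<and> i' < (d l)\<^sup>2 \<longrightarrow>
                   mat_trace (mat_adjoint (G l i) * G l i') =
                     (if i = i' then complex_of_real (\<kappa> l) else 0)"
    and sep: "fully_separable N d \<rho>"
  shows "tensor_trace_norm N (\<lambda>l. (d l)\<^sup>2 - 1) (corr_tensor N d \<kappa> G \<rho>)
           \<le> (\<Prod>l=1..N. sqrt ((real (d l) ^ 2 - real (d l)) / \<kappa> l))"
proof -
  let ?D = "\<lambda>l. (d l)\<^sup>2 - 1" and ?T = "corr_tensor N d \<kappa> G \<rho>"
  let ?M = "\<Prod>l=1..N. d l" and ?b = "\<lambda>l. (real (d l) ^ 2 - real (d l)) / \<kappa> l"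
  from sep obtain K :: nat and c :: "nat \<Rightarrow> real" and \<sigma> :: "nat \<Rightarrow> nat \<Rightarrow> complex mat"
    where \<rho>: "\<rho> \<in> carrier_mat ?M ?M"
      and c: "\<And>j. j < K \<Longrightarrow> 0 \<le> c j" and c1: "(\<Sum>j<K. c j) = 1"
      and \<sigma>: "\<And>j l. j < K \<Longrightarrow> l \<in> {1..N} \<Longrightarrow> pure_state (d l) (\<sigma> j l)"
      and \<rho>e: "\<And>a b. a < ?M \<Longrightarrow> b < ?M \<Longrightarrow> \<rho> $$ (a, b)
        = (\<Sum>j<K. complex_of_real (c j) * kron_list (map (\<sigma> j) [1..<N+1]) $$ (a, b))"
    unfolding fully_separable_def Let_def by blast
  \<comment> \<open>The global prefactor of the correlation tensor is distributed over the modes,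
    one quotient \<open>d l / \<kappa> l\<close> each, so that every pure product state contributes
    a genuine product tensor.\<close>
  define t where "t j l i = complex_of_real (real (d l) / \<kappa> l) * mat_trace (\<sigma> j l * G l i)" for j l i
  have set1N: "set [1..<N+1] = {1..N}" by auto
  have prodN: "(\<Prod>l\<leftarrow>[1..<N+1]. f l) = (\<Prod>l=1..N. f l)" for f :: "nat \<Rightarrow> 'b :: comm_monoid_mult"
    using prod.distinct_set_conv_list[of "[1..<N+1]" f] unfolding set1N by simp
  have \<sigma>c: "\<sigma> j l \<in> carrier_mat (d l) (d l)" if "j < K" "l \<in> {1..N}" for j l
    using \<sigma>[OF that] by (auto simp: pure_state_def)
  have T: "?T i = (\<Sum>j<K. complex_of_real (c j) * (\<Prod>l=1..N. t j l (i l)))"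
    if i: "valid_index N ?D i" for i
  proof -
    define g where "g = kron_list (map (\<lambda>l. G l (i l)) [1..<N+1])"
    have Gi: "G l (i l) \<in> carrier_mat (d l) (d l)" if l: "l \<in> {1..N}" for l
    proof -
      have "1 \<le> i l" "i l \<le> (d l)\<^sup>2 - 1" using i l by (auto simp: valid_index_def)
      thus ?thesis using Gcar l by auto
    qed
    have g: "g \<in> carrier_mat ?M ?M"
      unfolding g_def prodN[symmetric] by (rule kron_list_carrier) (use Gi set1N in blast)
    have s: "kron_list (map (\<sigma> j) [1..<N+1]) \<in> carrier_mat ?M ?M" if "j < K" for j
      unfolding prodN[symmetric] by (rule kron_list_carrier) (use \<sigma>c[OF that] set1N in blast)
    have "mat_trace (\<rho> * g) = (\<Sum>a<?M. \<Sum>b<?M. \<Sum>j<K. complex_of_real (c j) *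
        (kron_list (map (\<sigma> j) [1..<N+1]) $$ (a, b) * g $$ (b, a)))"
      unfolding mat_trace_mult[OF \<rho> g]
      by (intro sum.cong refl) (simp only: lessThan_iff \<rho>e sum_distrib_right mult.assoc)
    also have "\<dots> = (\<Sum>a<?M. \<Sum>j<K. \<Sum>b<?M. complex_of_real (c j) *
        (kron_list (map (\<sigma> j) [1..<N+1]) $$ (a, b) * g $$ (b, a)))"
      by (rule sum.cong[OF refl], rule sum.swap)
    also have "\<dots> = (\<Sum>j<K. \<Sum>a<?M. \<Sum>b<?M. complex_of_real (c j) *
        (kron_list (map (\<sigma> j) [1..<N+1]) $$ (a, b) * g $$ (b, a)))"
      by (rule sum.swap)
    also have "\<dots> = (\<Sum>j<K. complex_of_real (c j) * mat_trace (kron_list (map (\<sigma> j) [1..<N+1]) * g))"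
      by (intro sum.cong refl) (simp only: lessThan_iff mat_trace_mult[OF s g] sum_distrib_left)
    also have "\<dots> = (\<Sum>j<K. complex_of_real (c j) * (\<Prod>l=1..N. mat_trace (\<sigma> j l * G l (i l))))"
    proof (intro sum.cong refl arg_cong2[where f = "(*)"])
      fix j assume "j \<in> {..<K}"
      thus "mat_trace (kron_list (map (\<sigma> j) [1..<N+1]) * g) = (\<Prod>l=1..N. mat_trace (\<sigma> j l * G l (i l)))"
        unfolding g_def prodN[symmetric]
        by (intro mat_trace_kron_list_mult[where d = d]) (use \<sigma>c Gi set1N in blast)+
    qed
    finally show ?thesis
      unfolding corr_tensor_def g_def[symmetric] t_def prod.distrib
      by (simp add: prod_dividef sum_distrib_left mult_ac)
  qed
  have tb: "sqrt (\<Sum>x=1..?D l. (cmod (t j l x))\<^sup>2) \<le> sqrt (?b l)" if j: "j < K" and l: "l \<in> {1..N}" for j l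
  proof -
    have k: "0 < \<kappa> l" and dl: "1 \<le> d l" using kappa dpos l by force+
    have lt: "1 \<le> x \<and> x < (d l)\<^sup>2" if "x \<in> {1..?D l}" for x using that by auto
    have "(\<Sum>x=1..?D l. (cmod (t j l x))\<^sup>2)
        = (real (d l) / \<kappa> l)\<^sup>2 * (\<Sum>x=1..?D l. (cmod (mat_trace (\<sigma> j l * G l x)))\<^sup>2)"
      by (simp add: t_def norm_mult norm_divide power_mult_distrib power_divide sum_distrib_left)
    also have "\<dots> \<le> (real (d l) / \<kappa> l)\<^sup>2 * (\<kappa> l * (1 - 1 / real (d l)))"
      by (intro mult_left_mono pure_state_coefficients_le[OF dl k _ _ _ _ \<sigma>[OF j l]])
        (use lt Gcar Gtr Gorth l in auto)
    \<comment> \<open>\<open>(d / \<kappa>)\<^sup>2 * \<kappa> * (1 - 1/d)\<close> simplifies to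
      \<open>(d\<^sup>2 - d) / \<kappa>\<close>.\<close>
    also have "\<dots> = ?b l" using k dl by (simp add: field_simps power2_eq_square)
    finally show ?thesis by simp
  qed
  have bound: "trace_norm (mixed_unfolding N ?D ?T R n m) \<le> (\<Prod>l=1..N. sqrt (?b l))"
    if R: "R \<subseteq> {1..N}" "n \<le> card R" "m \<le> N - card R" for R n m
  proof -
    have "trace_norm (mixed_unfolding N ?D ?T R n m)
        \<le> (\<Sum>j<K. c j * (\<Prod>l=1..N. sqrt (\<Sum>x=1..?D l. (cmod (t j l x))\<^sup>2)))"
      by (rule trace_norm_mixed_unfolding_le[OF _ T R]) (simp_all add: c)
    also have "\<dots> \<le> (\<Sum>j<K. c j * (\<Prod>l=1..N. sqrt (?b l)))"
      by (intro sum_mono mult_left_mono prod_mono conjI tb c) (auto simp: sum_nonneg)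
    also have "\<dots> = (\<Prod>l=1..N. sqrt (?b l))" by (simp add: sum_distrib_right[symmetric] c1)
    finally show ?thesis .
  qed
  \<comment> \<open>A bound on \<open>Max\<close> can be checked memberwise only for a finite
    nonempty set, so both properties are established for the set of unfolding norms.\<close>
  let ?V = "{trace_norm (mixed_unfolding N ?D ?T R n m) | R n m.
    R \<subseteq> {1..N} \<and> R \<noteq> {} \<and> R \<noteq> {1..N} \<and> 1 \<le> n \<and> n \<le> card R \<and> 1 \<le> m \<and> m \<le> N - card R}"
  have "?V \<subseteq> (\<lambda>(R, n, m). trace_norm (mixed_unfolding N ?D ?T R n m)) ` (Pow {1..N} \<times> {..N} \<times> {..N})"
  proof
    fix y assume "y \<in> ?V"
    then obtain R n m where y: "y = trace_norm (mixed_unfolding N ?D ?T R n m)"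
      and R: "R \<subseteq> {1..N}" "n \<le> card R" "m \<le> N - card R" by blast
    have "card R \<le> N" using card_mono[OF _ R(1)] by simp
    thus "y \<in> (\<lambda>(R, n, m). trace_norm (mixed_unfolding N ?D ?T R n m)) ` (Pow {1..N} \<times> {..N} \<times> {..N})"
      using y R by (intro image_eqI[of _ _ "(R, n, m)"]) auto
  qed
  hence "finite ?V" by (rule finite_subset) simp
  \<comment> \<open>With \<open>N \<ge> 2\<close> the singleton \<open>{1}\<close> is a proper part
    of the modes, and \<open>n = m = 1\<close> is admissible for it.\<close>
  moreover have "?V \<noteq> {}"
  proof -
    have "2 \<in> {1..N}" "(2::nat) \<notin> {1}" using N2 by simp_all
    hence "{1} \<noteq> {1..N}" by metis
    hence "trace_norm (mixed_unfolding N ?D ?T {1} 1 1) \<in> ?V"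
      using N2 by (intro CollectI exI[of _ "{1}"] exI[of _ 1]) auto
    thus ?thesis by blast
  qed
  ultimately show ?thesis
    unfolding tensor_trace_norm_def using bound by (subst Max_le_iff) auto
qed

end
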